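(* For $f\in\mathbb{N}^{\mathbb{N}}$, the following are equivalent: (i) $f$ is hyperlow; (ii) for every $g\in\mathbb{N}^{\mathbb{N}}$, $g\in\Delta^1_1(f)$ if and only if there is a $\Delta^1_1$ total function $F:\mathbb{N}^{\mathbb{N}}\to\mathbb{N}^{\mathbb{N}}$ such that $F(f)=g$.
   Context: $\Sigma^1_1,\Pi^1_1$ are the lightface (effective) analytic and coanalytic pointclasses on products of copies of $\mathbb{N}$ and $\mathbb{N}^{\mathbb{N}}$, and $\Delta^1_1=\Sigma^1_1\cap\Pi^1_1$. For $f\in\mathbb{N}^{\mathbb{N}}$, $\Sigma^1_1(f)$ (resp. $\Pi^1_1(f)$) consists of the sections $Q_f=\{x: Q(f,x)\}$ of $\Sigma^1_1$ (resp. $\Pi^1_1$) sets $Q\subseteq\mathbb{N}^{\mathbb{N}}\times\mathcal{X}$, and $\Delta^1_1(f)=\Sigma^1_1(f)\cap\Pi^1_1(f)$. For $g\in\mathbb{N}^{\mathbb{N}}$, $g\in\Delta^1_1(f)$ means that the graph $\{(n,k):g(n)=k\}\subseteq\mathbb{N}^2$ is $\Delta^1_1(f)$. A total function $F:\mathbb{N}^{\mathbb{N}}\to\mathbb{N}^{\mathbb{N}}$ is $\Delta^1_1$ if the relation $\{(h,n,k): F(h)(n)=k\}\subseteq\mathbb{N}^{\mathbb{N}}\times\mathbb{N}^2$ is $\Delta^1_1$. $\omega_1^f$ is the least ordinal which is not the order type of an $f$-computable wellordering on $\mathbb{N}$; $\omega_1^{\mathrm{ck}}=\omega_1^{\emptyset}$.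 $f$ is hyperlow if $\omega_1^f=\omega_1^{\mathrm{ck}}$. *)

theory Defs
  imports Main
begin

unbundle cardinal_syntax

text \<open>Programs for Kleene's partial recursive functionals, with finitely many oracles in \<open>nat \<Rightarrow> nat\<close>.\<close>

datatype recf =
    Zero
  | Succ
  | Proj nat
  | Oracle nat
  | Comp recf "recf list"
  | Prec recf recf
  | Mu recf

text \<open>
  \<open>eval xs p ns v\<close>: with oracles \<open>xs\<close>, program \<open>p\<close> halts on input \<open>ns\<close> with output \<open>v\<close>.
  Arities are not tracked: a program applied to an input of the wrong shape has no output.
\<close>

inductive eval :: "(nat \<Rightarrow> nat) list \<Rightarrow> recf \<Rightarrow> nat list \<Rightarrow> nat \<Rightarrow> bool"
  for xs :: "(nat \<Rightarrow> nat) list" where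
  eval_Zero: "eval xs Zero ns 0"
| eval_Succ: "eval xs Succ [n] (Suc n)"
| eval_Proj: "i < length ns \<Longrightarrow> eval xs (Proj i) ns (ns ! i)"
| eval_Oracle: "i < length xs \<Longrightarrow> eval xs (Oracle i) [n] ((xs ! i) n)"
| eval_Comp: "list_all2 (\<lambda>q u. eval xs q ns u) qs us \<Longrightarrow> eval xs p us v
    \<Longrightarrow> eval xs (Comp p qs) ns v"
| eval_Prec_0: "eval xs p ns v \<Longrightarrow> eval xs (Prec p q) (0 # ns) v"
| eval_Prec_Suc: "eval xs (Prec p q) (n # ns) u \<Longrightarrow> eval xs q (n # u # ns) v
    \<Longrightarrow> eval xs (Prec p q) (Suc n # ns) v"
| eval_Mu: "eval xs p (n # ns) 0 \<Longrightarrow> \<forall>m<n. \<exists>k. eval xs p (m # ns) (Suc k)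
    \<Longrightarrow> eval xs (Mu p) ns n"

inductive_cases eval_ZeroE: "eval xs Zero ns v"
inductive_cases eval_SuccE: "eval xs Succ ns v"
inductive_cases eval_ProjE: "eval xs (Proj i) ns v"
inductive_cases eval_OracleE: "eval xs (Oracle i) ns v"
inductive_cases eval_CompE: "eval xs (Comp p qs) ns v"
inductive_cases eval_Prec_0E: "eval xs (Prec p q) (0 # ns) v"
inductive_cases eval_Prec_SucE: "eval xs (Prec p q) (Suc n # ns) v"
inductive_cases eval_MuE: "eval xs (Mu p) ns v"

lemma eval_deterministic: "eval xs p ns v \<Longrightarrow> eval xs p ns w \<Longrightarrow> v = w"
proof (induction arbitrary: w rule: eval.induct)
  case (eval_Zero ns)
  then show ?case by (elim eval_ZeroE) simp
next
  case (eval_Succ n)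
  then show ?case by (elim eval_SuccE) simp
next
  case (eval_Proj i ns)
  from eval_Proj.prems show ?case by (elim eval_ProjE) simp
next
  case (eval_Oracle i n)
  from eval_Oracle.prems show ?case by (elim eval_OracleE) simp
next
  case (eval_Comp ns qs us p v)
  from eval_Comp.prems obtain us' where
    us': "list_all2 (\<lambda>q u. eval xs q ns u) qs us'" "eval xs p us' w"
    by (rule eval_CompE)
  have "us = us'"
  proof (rule nth_equalityI)
    show "length us = length us'"
      using list_all2_lengthD[OF eval_Comp(1)] list_all2_lengthD[OF us'(1)] by simp
    show "us ! i = us' ! i" if "i < length us" for i
    proof -
      have i: "i < length qs"
        using list_all2_lengthD[OF eval_Comp(1)] that by simp
      have "eval xs (qs ! i) ns (us' ! i)" using us'(1) i by (rule list_all2_nthD)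
      then show ?thesis using list_all2_nthD[OF eval_Comp(1) i] by blast
    qed
  qed
  then show ?case using eval_Comp.IH(2) us'(2) by blast
next
  case (eval_Prec_0 p ns v q)
  from eval_Prec_0.prems show ?case by (rule eval_Prec_0E) (rule eval_Prec_0.IH)
next
  case (eval_Prec_Suc p q n ns u v)
  from eval_Prec_Suc.prems obtain u' where
    u': "eval xs (Prec p q) (n # ns) u'" "eval xs q (n # u' # ns) w"
    by (rule eval_Prec_SucE)
  then show ?case using eval_Prec_Suc.IH by blast
next
  case (eval_Mu p n ns)
  from eval_Mu.prems have w: "eval xs p (w # ns) 0" "\<forall>m<w. \<exists>k. eval xs p (m # ns) (Suc k)"
    by (rule eval_MuE, blast)+
  show ?case
  proof (cases n w rule: linorder_cases)
    case less
    then obtain k where "eval xs p (n # ns) (Suc k)" using w(2) by blast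
    then have "0 = Suc k" by (rule eval_Mu.IH(1))
    then show ?thesis by simp
  next
    case greater
    then obtain k where "Suc k = 0" using eval_Mu.IH(2) w(1) by blast
    then show ?thesis by simp
  qed
qed

text \<open>
  The points of \<open>\<nat>\<^sup>k \<times> (\<nat>\<^sup>\<nat>)\<^sup>l\<close>. Every product of copies of \<open>\<nat>\<close> and \<open>\<nat>\<^sup>\<nat>\<close> is of this form
  after listing its number coordinates first.
\<close>

type_synonym point = "nat list \<times> (nat \<Rightarrow> nat) list"

definition prod_space :: "nat \<Rightarrow> nat \<Rightarrow> point set" where
  "prod_space k l = {(ns, xs). length ns = k \<and> length xs = l}"

definition Sigma01 :: "nat \<Rightarrow> nat \<Rightarrow> point set set" where
  "Sigma01 k l = {{(ns, xs) \<in> prod_space k l. \<exists>v. eval xs p ns v} | p. True}"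

definition Pi01 :: "nat \<Rightarrow> nat \<Rightarrow> point set set" where
  "Pi01 k l = {prod_space k l - A | A. A \<in> Sigma01 k l}"

definition Sigma11 :: "nat \<Rightarrow> nat \<Rightarrow> point set set" where
  "Sigma11 k l =
    {{(ns, xs) \<in> prod_space k l. \<exists>y. (ns, y # xs) \<in> C} | C. C \<in> Pi01 k (Suc l)}"

definition Pi11 :: "nat \<Rightarrow> nat \<Rightarrow> point set set" where
  "Pi11 k l = {prod_space k l - A | A. A \<in> Sigma11 k l}"

definition Delta11 :: "nat \<Rightarrow> nat \<Rightarrow> point set set" where
  "Delta11 k l = Sigma11 k l \<inter> Pi11 k l"

definition sect :: "(nat \<Rightarrow> nat) \<Rightarrow> point set \<Rightarrow> point set" where
  "sect f Q = {(ns, xs). (ns, f # xs) \<in> Q}"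

definition Sigma11_in :: "(nat \<Rightarrow> nat) \<Rightarrow> nat \<Rightarrow> nat \<Rightarrow> point set set" where
  "Sigma11_in f k l = {sect f Q | Q. Q \<in> Sigma11 k (Suc l)}"

definition Pi11_in :: "(nat \<Rightarrow> nat) \<Rightarrow> nat \<Rightarrow> nat \<Rightarrow> point set set" where
  "Pi11_in f k l = {sect f Q | Q. Q \<in> Pi11 k (Suc l)}"

definition Delta11_in :: "(nat \<Rightarrow> nat) \<Rightarrow> nat \<Rightarrow> nat \<Rightarrow> point set set" where
  "Delta11_in f k l = Sigma11_in f k l \<inter> Pi11_in f k l"

definition is_Delta11_in :: "(nat \<Rightarrow> nat) \<Rightarrow> (nat \<Rightarrow> nat) \<Rightarrow> bool" where
  "is_Delta11_in g f \<longleftrightarrow> {([n, k], []) | n k. g n = k} \<in> Delta11_in f 2 0"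

definition Delta11_function :: "((nat \<Rightarrow> nat) \<Rightarrow> (nat \<Rightarrow> nat)) \<Rightarrow> bool" where
  "Delta11_function F \<longleftrightarrow> {([n, k], [h]) | n k h. F h n = k} \<in> Delta11 2 1"

definition computable_rel :: "(nat \<Rightarrow> nat) \<Rightarrow> nat rel \<Rightarrow> bool" where
  "computable_rel f R \<longleftrightarrow>
    (\<exists>p. \<forall>m n. eval [f] p [m, n] (if (m, n) \<in> R then 1 else 0))"

text \<open>
  As usual in this context, a wellordering on \<open>\<nat>\<close> may have any subset of \<open>\<nat>\<close> as its field; if
  the field had to be all of \<open>\<nat>\<close>, then no finite ordinal would be an order type.
\<close>

definition computable_wellorder :: "(nat \<Rightarrow> nat) \<Rightarrow> nat rel \<Rightarrow> bool" where
  "computable_wellorder f R \<longleftrightarrow> Well_order R \<and> computable_rel f R"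

text \<open>
  \<open>is_omega1 f r\<close>: the order type of \<open>r\<close> is \<open>\<omega>\<^sub>1\<^sup>f\<close>. Countable ordinals are represented by
  wellorders on subsets of \<open>\<nat>\<close>, which suffices since \<open>\<omega>\<^sub>1\<^sup>f\<close> is countable.
\<close>

definition is_omega1 :: "(nat \<Rightarrow> nat) \<Rightarrow> nat rel \<Rightarrow> bool" where
  "is_omega1 f r \<longleftrightarrow>
     Well_order r \<and>
     \<not> (\<exists>R. computable_wellorder f R \<and> R =o r) \<and>
     (\<forall>s :: nat rel. s <o r \<longrightarrow> (\<exists>R. computable_wellorder f R \<and> R =o s))"

lemma is_omega1_unique:
  assumes r: "is_omega1 f r" and s: "is_omega1 f s"
  shows "r =o s"
proof -
  have W: "Well_order r" "Well_order s" using r s by (simp_all add: is_omega1_def)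
  have "\<not> s <o r" "\<not> r <o s" using r s unfolding is_omega1_def by blast+
  then show ?thesis
    using W not_ordLess_iff_ordLeq ordIso_iff_ordLeq by blast
qed

text \<open>The oracle \<open>\<lambda>_. 0\<close> is the characteristic function of the empty set.\<close>

definition hyperlow :: "(nat \<Rightarrow> nat) \<Rightarrow> bool" where
  "hyperlow f \<longleftrightarrow> (\<exists>r s. is_omega1 f r \<and> is_omega1 (\<lambda>_. 0) s \<and> r =o s)"

end

theory Submission
  imports Defs "HOL-Library.Nat_Bijection"
begin

text \<open>
  Write a \<open>\<Pi>\<^sup>1\<^sub>1\<close> set as the set of points whose recursive tree is wellfounded. By boundedness, the ranks of
  these trees over a \<open>\<Delta>\<^sup>1\<^sub>1(f)\<close> subset are bounded by an \<open>f\<close>-computable wellorder, namely the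
  Kleene--Brouwer order of a joint tree. On the other hand, for a wellorder \<open>R\<close> that is computable from
  \<open>h\<close>, comparing ranks with \<open>R\<close> is \<open>\<Delta>\<^sup>1\<^sub>1(h)\<close>, because the hierarchy of rank comparisons along \<open>R\<close> is
  the unique solution of an arithmetical condition.

  If \<open>f\<close> is hyperlow and the graph of \<open>g\<close> is \<open>\<Delta>\<^sup>1\<^sub>1(f)\<close>, then the bounding wellorder can be taken computable, and
  \<open>F h n\<close> is the least \<open>k\<close> such that the tree of \<open>h\<close>, \<open>n\<close> and \<open>k\<close> is ranked by it (or \<open>0\<close>).

  If \<open>f\<close> is not hyperlow, some \<open>f\<close>-computable wellorder \<open>R\<close> is longer than all computable ones, so that it
  bounds the ranks in the trees of every total \<open>\<Delta>\<^sup>1\<^sub>1\<close> function, and selecting values with \<open>R\<close> from a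
  universal \<open>\<Pi>\<^sup>1\<^sub>1\<close> set yields a function in \<open>\<Delta>\<^sup>1\<^sub>1(f)\<close> that differs from \<open>F f\<close> at the code of \<open>F\<close>.
\<close>

section \<open>Computable functionals\<close>

text \<open>Rank comparison with an order \<open>R\<close> is pinned down by its recursion only
  where \<open>R\<close> is wellfounded. An order computed from \<open>f\<close> can become
  illfounded when its program is run with another oracle \<open>h\<close>, so it is of no use for a
  function that must be \<open>\<Delta>\<^sup>1\<^sub>1\<close> on all reals; a computable order
  ignores \<open>h\<close>. Hyperlowness is what allows the replacement: the order given by
  boundedness is \<open>f\<close>-computable, hence shorter than
  \<open>\<omega>\<^sub>1\<^sup>f\<close>. In the converse direction the selection matters only at
  \<open>f\<close>, so misbehaviour at other oracles is harmless. What must be uniform there is the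
  bound: the graph of a total \<open>\<Delta>\<^sup>1\<^sub>1\<close> function is lightface, so
  boundedness applied to all reals at once yields an order that is computable without
  \<open>f\<close>. In the row of the code of \<open>F\<close> exactly one value is ranked, and the
  selection returns its successor.\<close>

lemma eval_Comp1: "eval xs q ns u \<Longrightarrow> eval xs p [u] v \<Longrightarrow> eval xs (Comp p [q]) ns v"
  by (rule eval_Comp[where us = "[u]"]) simp_all

lemma eval_Comp2:
  "eval xs q ns u \<Longrightarrow> eval xs q' ns u' \<Longrightarrow> eval xs p [u, u'] v \<Longrightarrow> eval xs (Comp p [q, q']) ns v"
  by (rule eval_Comp[where us = "[u, u']"]) simp_all

lemma eval_Proj_eq: "i < length ns \<Longrightarrow> ns ! i = v \<Longrightarrow> eval xs (Proj i) ns v"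
  using eval_Proj by blast

section \<open>Programs for arithmetic and for Cantor pairing\<close>

abbreviation pair :: "nat \<Rightarrow> nat \<Rightarrow> nat" where
  "pair a b \<equiv> prod_encode (a, b)"

definition pfst :: "nat \<Rightarrow> nat" where "pfst c = fst (prod_decode c)"
definition psnd :: "nat \<Rightarrow> nat" where "psnd c = snd (prod_decode c)"

lemma pfst_pair [simp]: "pfst (pair a b) = a" by (simp add: pfst_def)
lemma psnd_pair [simp]: "psnd (pair a b) = b" by (simp add: psnd_def)
lemma pair_pfst_psnd [simp]: "pair (pfst c) (psnd c) = c" by (simp add: pfst_def psnd_def)

definition add_prog :: recf where "add_prog = Prec (Proj 0) (Comp Succ [Proj 1])"
definition pred_prog :: recf where "pred_prog = Prec Zero (Proj 0)"
definition sub_prog :: recf where "sub_prog = Prec (Proj 0) (Comp pred_prog [Proj 1])"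
definition triangle_prog :: recf where
  "triangle_prog = Prec Zero (Comp add_prog [Proj 1, Comp Succ [Proj 0]])"
definition pair_prog :: recf where
  "pair_prog = Comp add_prog [Comp triangle_prog [add_prog], Proj 0]"
text \<open>Since \<open>pair a b = triangle (a + b) + a\<close>, the sum \<open>a + b\<close> is
  the least \<open>w\<close> with \<open>c < triangle (Suc w)\<close>; the searched zero is that of
  \<open>Suc c - triangle (Suc w)\<close>.\<close>

definition root_prog :: recf where
  "root_prog = Mu (Comp sub_prog [Comp triangle_prog [Comp Succ [Proj 0]], Comp Succ [Proj 1]])"
definition pfst_prog :: recf where
  "pfst_prog = Comp sub_prog [Comp triangle_prog [root_prog], Proj 0]"
definition psnd_prog :: recf where
  "psnd_prog = Comp sub_prog [pfst_prog, root_prog]"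

lemma eval_add_prog: "eval xs add_prog [m, n] (m + n)"
proof (induction m)
  case 0
  show ?case by (auto simp: add_prog_def intro!: eval_Prec_0 eval_Proj_eq)
next
  case (Suc m)
  then show ?case unfolding add_prog_def
    by (rule eval_Prec_Suc) (auto intro!: eval_Comp1 eval_Proj_eq eval_Succ)
qed

lemma eval_pred_prog: "eval xs pred_prog [n] (n - 1)"
proof (induction n)
  case 0
  show ?case by (auto simp: pred_prog_def intro!: eval_Prec_0 eval_Zero)
next
  case (Suc n)
  then show ?case unfolding pred_prog_def
    by (rule eval_Prec_Suc) (auto intro!: eval_Proj_eq)
qed

lemma eval_sub_prog: "eval xs sub_prog [m, n] (n - m)"
proof (induction m)
  case 0
  show ?case by (auto simp: sub_prog_def intro!: eval_Prec_0 eval_Proj_eq)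
next
  case (Suc m)
  have "eval xs (Comp pred_prog [Proj 1]) [m, n - m, n] (n - m - 1)"
    by (rule eval_Comp1[OF eval_Proj_eq eval_pred_prog]) simp_all
  with Suc show ?case unfolding sub_prog_def
    by (auto dest: eval_Prec_Suc)
qed

lemma eval_triangle_prog: "eval xs triangle_prog [n] (triangle n)"
proof (induction n)
  case 0
  show ?case by (auto simp: triangle_prog_def intro!: eval_Prec_0 eval_Zero)
next
  case (Suc n)
  have "eval xs (Comp add_prog [Proj 1, Comp Succ [Proj 0]]) [n, triangle n] (triangle n + Suc n)"
    by (rule eval_Comp2[OF eval_Proj_eq eval_Comp1[OF eval_Proj_eq eval_Succ] eval_add_prog]) simp_all
  with Suc show ?case unfolding triangle_prog_def
    by (auto dest: eval_Prec_Suc)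
qed

lemma eval_pair_prog: "eval xs pair_prog [a, b] (pair a b)"
  unfolding pair_prog_def prod_encode_def prod.case
  by (rule eval_Comp2[OF eval_Comp1[OF eval_add_prog eval_triangle_prog] _ eval_add_prog])
    (simp add: eval_Proj_eq)

lemma triangle_mono: "m \<le> n \<Longrightarrow> triangle m \<le> triangle n"
  by (induction n) (auto simp: le_Suc_eq)

lemma eval_root_prog: "eval xs root_prog [c] (pfst c + psnd c)"
proof -
  let ?w = "pfst c + psnd c"
  have c: "c = triangle ?w + pfst c"
    using pair_pfst_psnd[of c] by (simp add: prod_encode_def)
  have ev: "eval xs (Comp sub_prog [Comp triangle_prog [Comp Succ [Proj 0]], Comp Succ [Proj 1]]) [w, c]
      (Suc c - triangle (Suc w))" for w
    by (rule eval_Comp2[OF eval_Comp1[OF eval_Comp1[OF eval_Proj_eq eval_Succ] eval_triangle_prog]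
          eval_Comp1[OF eval_Proj_eq eval_Succ] eval_sub_prog]) simp_all
  show ?thesis unfolding root_prog_def
  proof (rule eval_Mu)
    have "Suc c - triangle (Suc ?w) = 0" using c by simp
    then show "eval xs (Comp sub_prog [Comp triangle_prog [Comp Succ [Proj 0]], Comp Succ [Proj 1]])
        (?w # [c]) 0" using ev[of ?w] by simp
    show "\<forall>m<?w. \<exists>k. eval xs (Comp sub_prog [Comp triangle_prog [Comp Succ [Proj 0]], Comp Succ [Proj 1]])
        (m # [c]) (Suc k)"
    proof (intro allI impI)
      fix m assume "m < ?w"
      then have "triangle (Suc m) \<le> triangle ?w" by (intro triangle_mono) simp
      then have "Suc c - triangle (Suc m) = Suc (c - triangle (Suc m))" using c by linarith
      then show "\<exists>k. eval xs (Comp sub_prog [Comp triangle_prog [Comp Succ [Proj 0]], Comp Succ [Proj 1]])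
          (m # [c]) (Suc k)" using ev[of m] by auto
    qed
  qed
qed

lemma eval_pfst_prog: "eval xs pfst_prog [c] (pfst c)"
proof -
  have "pfst c = c - triangle (pfst c + psnd c)"
    using pair_pfst_psnd[of c] by (simp add: prod_encode_def)
  moreover have "eval xs pfst_prog [c] (c - triangle (pfst c + psnd c))"
    unfolding pfst_prog_def
    by (rule eval_Comp2[OF eval_Comp1[OF eval_root_prog eval_triangle_prog] eval_Proj_eq eval_sub_prog])
      simp_all
  ultimately show ?thesis by simp
qed

lemma eval_psnd_prog: "eval xs psnd_prog [c] (psnd c)"
  using eval_Comp2[OF eval_pfst_prog eval_root_prog eval_sub_prog, of xs c]
  by (simp add: psnd_prog_def)

text \<open>
  All number arguments are packed into \<open>c\<close>; the real arguments form \<open>r\<close> of any type, and \<open>D r\<close> lists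
  the oracles.
\<close>

definition cfun :: "('r \<Rightarrow> (nat \<Rightarrow> nat) list) \<Rightarrow> (nat \<Rightarrow> 'r \<Rightarrow> nat) \<Rightarrow> bool" where
  "cfun D F \<longleftrightarrow> (\<exists>p. \<forall>c r. eval (D r) p [c] (F c r))"

definition decp :: "('r \<Rightarrow> (nat \<Rightarrow> nat) list) \<Rightarrow> (nat \<Rightarrow> 'r \<Rightarrow> bool) \<Rightarrow> bool" where
  "decp D P \<longleftrightarrow> cfun D (\<lambda>c r. of_bool (P c r))"

definition single :: "(nat \<Rightarrow> nat) \<Rightarrow> (nat \<Rightarrow> nat) list" where "single z = [z]"

section \<open>Closure properties of total computable functionals\<close>

named_theorems cintros

lemma cfunE:
  assumes "cfun D F" obtains p where "\<And>c r. eval (D r) p [c] (F c r)"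
  using assms unfolding cfun_def by blast

lemma cfunI: "(\<And>c r. eval (D r) p [c] (F c r)) \<Longrightarrow> cfun D F"
  unfolding cfun_def by blast

lemma cfun_app1:
  assumes "\<And>xs a. eval xs p [a] (g a)" "cfun D F"
  shows "cfun D (\<lambda>c r. g (F c r))"
proof -
  obtain q where q: "\<And>c r. eval (D r) q [c] (F c r)" using assms(2) by (rule cfunE) blast
  show ?thesis by (rule cfunI[where p = "Comp p [q]"], rule eval_Comp1[OF q assms(1)])
qed

lemma cfun_app2:
  assumes "\<And>xs a b. eval xs p [a, b] (g a b)" "cfun D F" "cfun D G"
  shows "cfun D (\<lambda>c r. g (F c r) (G c r))"
proof -
  obtain q where q: "\<And>c r. eval (D r) q [c] (F c r)" using assms(2) by (rule cfunE) blast
  obtain q' where q': "\<And>c r. eval (D r) q' [c] (G c r)" using assms(3) by (rule cfunE) blast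
  show ?thesis by (rule cfunI[where p = "Comp p [q, q']"], rule eval_Comp2[OF q q' assms(1)])
qed

lemma cfun_comp:
  assumes "cfun D F" "cfun D t"
  shows "cfun D (\<lambda>c r. F (t c r) r)"
proof -
  obtain q where q: "\<And>c r. eval (D r) q [c] (F c r)" using assms(1) by (rule cfunE) blast
  obtain q' where q': "\<And>c r. eval (D r) q' [c] (t c r)" using assms(2) by (rule cfunE) blast
  show ?thesis by (rule cfunI[where p = "Comp q [q']"], rule eval_Comp1[OF q' q])
qed

lemma cfun_id [cintros]: "cfun D (\<lambda>c r. c)"
  by (rule cfunI[where p = "Proj 0"]) (simp add: eval_Proj_eq)

lemma cfun_zero: "cfun D (\<lambda>c r. 0)"
  by (rule cfunI[where p = Zero]) (rule eval_Zero)

lemma cfun_Suc [cintros]: "cfun D F \<Longrightarrow> cfun D (\<lambda>c r. Suc (F c r))"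
  by (rule cfun_app1[of Succ Suc]) (rule eval_Succ)

lemma cfun_const [cintros]: "cfun D (\<lambda>c r. n)"
proof (induction n)
  case (Suc n)
  then show ?case by (rule cfun_Suc)
qed (rule cfun_zero)

lemma cfun_add [cintros]: "cfun D F \<Longrightarrow> cfun D G \<Longrightarrow> cfun D (\<lambda>c r. F c r + G c r)"
  by (rule cfun_app2[of add_prog "(+)"]) (rule eval_add_prog)

lemma cfun_sub [cintros]: "cfun D F \<Longrightarrow> cfun D G \<Longrightarrow> cfun D (\<lambda>c r. F c r - G c r)"
  by (rule cfun_app2[of sub_prog "\<lambda>a b. b - a" D G F]) (rule eval_sub_prog)

lemma cfun_pair [cintros]: "cfun D F \<Longrightarrow> cfun D G \<Longrightarrow> cfun D (\<lambda>c r. pair (F c r) (G c r))"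
  by (rule cfun_app2[of pair_prog pair]) (rule eval_pair_prog)

lemma cfun_pfst [cintros]: "cfun D F \<Longrightarrow> cfun D (\<lambda>c r. pfst (F c r))"
  by (rule cfun_app1[of pfst_prog pfst]) (rule eval_pfst_prog)

lemma cfun_psnd [cintros]: "cfun D F \<Longrightarrow> cfun D (\<lambda>c r. psnd (F c r))"
  by (rule cfun_app1[of psnd_prog psnd]) (rule eval_psnd_prog)

lemma cfun_oracle:
  assumes "\<And>r. i < length (D r)" "cfun D t"
  shows "cfun D (\<lambda>c r. (D r ! i) (t c r))"
proof -
  obtain q where q: "\<And>c r. eval (D r) q [c] (t c r)" using assms(2) by (rule cfunE) blast
  show ?thesis
    by (rule cfunI[where p = "Comp (Oracle i) [q]"], rule eval_Comp1[OF q eval_Oracle[OF assms(1)]])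
qed

lemma cfun_single [cintros]: "cfun single t \<Longrightarrow> cfun single (\<lambda>c z. z (t c z))"
  using cfun_oracle[of 0 single t] by (simp add: single_def)

lemma cfun_rec [cintros]:
  assumes "cfun D f" "cfun D (\<lambda>c r. g (pfst c) (pfst (psnd c)) (psnd (psnd c)) r)" "cfun D t"
  shows "cfun D (\<lambda>c r. rec_nat (f c r) (\<lambda>i u. g i u c r) (t c r))"
proof -
  obtain p where p: "\<And>c r. eval (D r) p [c] (f c r)" using assms(1) by (rule cfunE) blast
  obtain q where q: "\<And>c r. eval (D r) q [c] (g (pfst c) (pfst (psnd c)) (psnd (psnd c)) r)"
    using assms(2) by (rule cfunE) blast
  obtain s where s: "\<And>c r. eval (D r) s [c] (t c r)" using assms(3) by (rule cfunE) blast
  let ?q = "Comp q [Comp pair_prog [Proj 0, Comp pair_prog [Proj 1, Proj 2]]]"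
  have q': "eval (D r) ?q [i, u, c] (g i u c r)" for i u c r
  proof (rule eval_Comp1)
    show "eval (D r) (Comp pair_prog [Proj 0, Comp pair_prog [Proj 1, Proj 2]]) [i, u, c]
        (pair i (pair u c))"
      by (rule eval_Comp2[OF _ eval_Comp2[OF _ _ eval_pair_prog] eval_pair_prog])
        (simp_all add: eval_Proj_eq)
    show "eval (D r) q [pair i (pair u c)] (g i u c r)"
      using q[of r "pair i (pair u c)"] by simp
  qed
  have "eval (D r) (Prec p ?q) [n, c] (rec_nat (f c r) (\<lambda>i u. g i u c r) n)" for n c r
  proof (induction n)
    case 0
    show ?case using p by (auto intro!: eval_Prec_0)
  next
    case (Suc n)
    show ?case using eval_Prec_Suc[OF Suc q'] by simp
  qed
  then show ?thesis
    by (intro cfunI[where p = "Comp (Prec p ?q) [s, Proj 0]"] eval_Comp2[OF s eval_Proj_eq])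
      simp_all
qed

lemma cfun_Least:
  assumes "decp D (\<lambda>c r. P (pfst c) (psnd c) r)" "\<And>c r. \<exists>n. P n c r"
  shows "cfun D (\<lambda>c r. LEAST n. P n c r)"
proof -
  have "cfun D (\<lambda>c r. 1 - of_bool (P (pfst c) (psnd c) r))"
    using assms(1) unfolding decp_def by (rule cfun_sub[OF cfun_const])
  then obtain q where q: "\<And>c r. eval (D r) q [c] (1 - of_bool (P (pfst c) (psnd c) r))"
    by (rule cfunE) blast
  let ?q = "Comp q [pair_prog]"
  have q': "eval (D r) ?q [n, c] (1 - of_bool (P n c r))" for n c r
    using eval_Comp1[OF eval_pair_prog q, of r n c] by simp
  show ?thesis
  proof (rule cfunI[where p = "Mu ?q"], rule eval_Mu)
    fix c r
    have "P (LEAST n. P n c r) c r" using assms(2)[of c r] by (rule LeastI_ex)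
    then show "eval (D r) ?q [LEAST n. P n c r, c] 0" using q'[of r "LEAST n. P n c r" c] by simp
    show "\<forall>m<LEAST n. P n c r. \<exists>k. eval (D r) ?q [m, c] (Suc k)"
    proof (intro allI impI)
      fix m assume "m < (LEAST n. P n c r)"
      then have "\<not> P m c r" by (rule not_less_Least)
      then show "\<exists>k. eval (D r) ?q [m, c] (Suc k)" using q'[of r m c] by auto
    qed
  qed
qed

lemma cfun_of_bool [cintros]: "decp D P \<Longrightarrow> cfun D (\<lambda>c r. of_bool (P c r))"
  by (simp add: decp_def)

lemma cfun_If [cintros]:
  assumes "decp D P" "cfun D F" "cfun D G"
  shows "cfun D (\<lambda>c r. if P c r then F c r else G c r)"
proof -
  have *: "cfun D (\<lambda>c r. rec_nat (G c r) (\<lambda>_ _. F c r) (of_bool (P c r)))"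
    by (intro cfun_rec assms cfun_comp[OF assms(2)] cintros cfun_of_bool)
  have "(\<lambda>c r. rec_nat (G c r) (\<lambda>_ _. F c r) (of_bool (P c r)))
      = (\<lambda>c r. if P c r then F c r else G c r)"
    by (intro ext) simp
  with * show ?thesis by simp
qed

lemma decp_comp:
  assumes "decp D P" "cfun D t" shows "decp D (\<lambda>c r. P (t c r) r)"
  using cfun_comp[of D "\<lambda>c r. of_bool (P c r)"] assms unfolding decp_def by blast

lemma decp_nonzero:
  assumes "cfun D F" shows "decp D (\<lambda>c r. F c r \<noteq> 0)"
proof -
  have "(of_bool (F c r \<noteq> 0) :: nat) = 1 - (1 - F c r)" for c r by auto
  then show ?thesis unfolding decp_def using assms by (simp only:) (intro cintros)
qed

lemma decp_not [cintros]: "decp D P \<Longrightarrow> decp D (\<lambda>c r. \<not> P c r)"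
proof -
  have "(of_bool (\<not> P c r) :: nat) = 1 - of_bool (P c r)" for c r by simp
  then show "decp D P \<Longrightarrow> decp D (\<lambda>c r. \<not> P c r)" by (simp only: decp_def[of D "\<lambda>c r. \<not> P c r"]) (intro cintros)
qed

lemma decp_conj [cintros]: "decp D P \<Longrightarrow> decp D Q \<Longrightarrow> decp D (\<lambda>c r. P c r \<and> Q c r)"
proof -
  have "(of_bool (P c r \<and> Q c r) :: nat) = (if P c r then of_bool (Q c r) else 0)" for c r by simp
  then show "decp D P \<Longrightarrow> decp D Q \<Longrightarrow> decp D (\<lambda>c r. P c r \<and> Q c r)"
    unfolding decp_def[of D "\<lambda>c r. P c r \<and> Q c r"] by (simp only:) (intro cintros)
qed

lemma decp_disj [cintros]:
  assumes "decp D P" "decp D Q" shows "decp D (\<lambda>c r. P c r \<or> Q c r)"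
  using decp_not[OF decp_conj[OF decp_not[OF assms(1)] decp_not[OF assms(2)]]] by simp

lemma decp_imp [cintros]:
  assumes "decp D P" "decp D Q" shows "decp D (\<lambda>c r. P c r \<longrightarrow> Q c r)"
  using decp_disj[OF decp_not[OF assms(1)] assms(2)] by simp

lemma decp_le [cintros]:
  assumes "cfun D F" "cfun D G" shows "decp D (\<lambda>c r. F c r \<le> G c r)"
  using decp_not[OF decp_nonzero[OF cfun_sub[OF assms]]] by simp

lemma decp_less [cintros]:
  assumes "cfun D F" "cfun D G" shows "decp D (\<lambda>c r. F c r < G c r)"
  using decp_nonzero[OF cfun_sub[OF assms(2,1)]] by (simp add: not_le)

lemma decp_eq [cintros]:
  assumes "cfun D F" "cfun D G" shows "decp D (\<lambda>c r. F c r = G c r)"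
  using decp_conj[OF decp_le[OF assms] decp_le[OF assms(2,1)]] unfolding order.eq_iff[symmetric] .

lemma decp_ball [cintros]:
  assumes "cfun D t" "decp D (\<lambda>c r. P (pfst c) (psnd c) r)"
  shows "decp D (\<lambda>c r. \<forall>i<t c r. P i c r)"
proof -
  have "cfun D (\<lambda>c r. rec_nat 1 (\<lambda>i u. if P i c r then u else 0) (t c r))"
    by (rule cfun_rec[where f = "\<lambda>_ _. 1"], rule cfun_const, rule cfun_If)
      (use decp_comp[OF assms(2), of "\<lambda>c r. pair (pfst c) (psnd (psnd c))"] assms(1)
        in \<open>simp_all add: cfun_pair cfun_pfst cfun_psnd cfun_id cfun_const\<close>)
  moreover have "rec_nat 1 (\<lambda>i u. if P i c r then u else 0) n = (of_bool (\<forall>i<n. P i c r) :: nat)" for n c r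
    by (induction n) (auto simp: less_Suc_eq)
  ultimately show ?thesis by (simp add: decp_def)
qed

lemma decp_bex [cintros]:
  assumes "cfun D t" "decp D (\<lambda>c r. P (pfst c) (psnd c) r)"
  shows "decp D (\<lambda>c r. \<exists>i<t c r. P i c r)"
  using decp_not[OF decp_ball[OF assms(1) decp_not[OF assms(2)]]] by simp

lemma cfun_times2 [cintros]:
  assumes "cfun D F" shows "cfun D (\<lambda>c r. 2 * F c r)"
  using cfun_add[OF assms assms] by (simp add: mult_2)

lemma cfun_div2 [cintros]:
  assumes "cfun D F" shows "cfun D (\<lambda>c r. F c r div 2)"
proof -
  have "(LEAST n. m < 2 * n + 2) = m div 2" for m :: nat
    by (rule Least_equality) auto
  moreover have "cfun D (\<lambda>m r. LEAST n. m < 2 * n + 2)"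
    by (intro cfun_Least cintros) presburger
  ultimately have "cfun D (\<lambda>m r. m div 2)" by simp
  from cfun_comp[OF this assms] show ?thesis by simp
qed

lemma decp_even [cintros]:
  assumes "cfun D F" shows "decp D (\<lambda>c r. even (F c r))"
proof -
  have "decp D (\<lambda>c r. 2 * (F c r div 2) = F c r)" using assms by (intro cintros)
  moreover have "2 * (n div 2) = n \<longleftrightarrow> even n" for n :: nat by presburger
  ultimately show ?thesis by simp
qed

text \<open>Finite sequences are lists with the newest entry first; they are coded by \<^const>\<open>list_encode\<close>.\<close>

definition ext :: "nat list \<Rightarrow> nat \<Rightarrow> nat" where
  "ext s i = (if i < length s then rev s ! i else 0)"

lemma cfun_drop:
  assumes "cfun D F" "cfun D G"
  shows "cfun D (\<lambda>c r. list_encode (drop (F c r) (list_decode (G c r))))"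
proof -
  \<comment> \<open>This also holds for \<open>a = 0\<close>, the code of the empty list, because 0
    decodes to a pair of zeros.\<close>
  have tl: "psnd (a - 1) = list_encode (tl (list_decode a))" for a
  proof (cases a)
    case 0
    then show ?thesis by (simp add: psnd_def prod_decode_def prod_decode_aux.simps)
  next
    case (Suc n)
    then show ?thesis by (auto simp: psnd_def split: prod.splits)
  qed
  have "rec_nat a (\<lambda>_ u. psnd (u - 1)) n = list_encode (drop n (list_decode a))" for n a
    by (induction n) (simp_all add: tl[simplified] drop_Suc tl_drop)
  moreover have "cfun D (\<lambda>c r. rec_nat (G c r) (\<lambda>_ u. psnd (u - 1)) (F c r))"
    using assms by (intro cintros)
  ultimately show ?thesis by simp
qed

lemma cfun_length [cintros]:
  assumes "cfun D F" shows "cfun D (\<lambda>c r. length (list_decode (F c r)))"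
proof -
  have e: "list_encode xs = 0 \<longleftrightarrow> xs = []" for xs
    by (cases xs) auto
  have "(LEAST n. list_encode (drop n (list_decode a)) = 0) = length (list_decode a)" for a
    by (rule Least_equality) (auto simp: e)
  moreover have "cfun D (\<lambda>a r. LEAST n. list_encode (drop n (list_decode a)) = 0)"
    by (intro cfun_Least cintros cfun_drop) (auto simp: e)
  ultimately have "cfun D (\<lambda>a r. length (list_decode a))" by simp
  from cfun_comp[OF this assms] show ?thesis by simp
qed

lemma cfun_nth:
  assumes "cfun D F" "cfun D G"
  shows "cfun D (\<lambda>c r. if G c r < length (list_decode (F c r)) then list_decode (F c r) ! G c r else 0)"
proof -
  have "(if n < length (list_decode a) then list_decode a ! n else 0)
      = pfst (list_encode (drop n (list_decode a)) - 1)" for n a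
  proof (cases "n < length (list_decode a)")
    case True
    then show ?thesis by (simp add: Cons_nth_drop_Suc[symmetric])
  next
    case False
    then show ?thesis by (simp add: pfst_def prod_decode_def prod_decode_aux.simps)
  qed
  then show ?thesis using assms by (simp only:) (intro cintros cfun_drop)
qed

lemma cfun_ext [cintros]:
  assumes "cfun D F" "cfun D G" shows "cfun D (\<lambda>c r. ext (list_decode (F c r)) (G c r))"
proof -
  have "ext s i = (if i < length s then (if length s - Suc i < length s
      then s ! (length s - Suc i) else 0) else 0)" for s i
    by (auto simp: ext_def rev_nth)
  then show ?thesis using assms by (simp only:) (intro cintros cfun_nth)
qed

section \<open>Bounded evaluation\<close>

text \<open>
  Evaluation with minimisation and oracle queries bounded by \<open>N\<close>; the value \<open>0\<close> means that the
  bound does not suffice, and \<open>Suc v\<close> is the output \<open>v\<close>.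
\<close>

fun ev :: "nat \<Rightarrow> (nat \<Rightarrow> nat) list \<Rightarrow> recf \<Rightarrow> nat list \<Rightarrow> nat" where
  "ev N xs Zero ns = 1"
| "ev N xs Succ ns = (if length ns = 1 then Suc (Suc (hd ns)) else 0)"
| "ev N xs (Proj i) ns = (if i < length ns then Suc (ns ! i) else 0)"
| "ev N xs (Oracle i) ns =
    (if i < length xs \<and> length ns = 1 \<and> hd ns < N then Suc ((xs ! i) (hd ns)) else 0)"
| "ev N xs (Comp p qs) ns =
    (if \<exists>q\<in>set qs. ev N xs q ns = 0 then 0 else ev N xs p (map (\<lambda>q. ev N xs q ns - 1) qs))"
| "ev N xs (Prec p q) ns = (case ns of [] \<Rightarrow> 0 | n # ms \<Rightarrow>
    rec_nat (ev N xs p ms) (\<lambda>i u. if u = 0 then 0 else ev N xs q (i # (u - 1) # ms)) n)"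
| "ev N xs (Mu p) ns = (let n = LEAST n. N \<le> n \<or> ev N xs p (n # ns) \<le> 1
    in if n < N \<and> ev N xs p (n # ns) = 1 then Suc n else 0)"

text \<open>The disjunct \<open>N \<le> n\<close> makes the least number exist, and the search also
  stops at an undefined value 0; only a stop below \<open>N\<close> at the value 1, that is at
  output 0, counts as a result.\<close>

lemma ev_Mu_eq_Suc:
  "ev N xs (Mu p) ns = Suc v \<longleftrightarrow>
    v < N \<and> ev N xs p (v # ns) = 1 \<and> (\<forall>m<v. 1 < ev N xs p (m # ns))"
proof -
  let ?P = "\<lambda>n. N \<le> n \<or> ev N xs p (n # ns) \<le> 1"
  define n where "n = (LEAST n. ?P n)"
  have "?P n" unfolding n_def by (rule LeastI[of ?P N]) simp
  have less: "\<not> ?P m" if "m < n" for m using that unfolding n_def by (rule not_less_Least)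
  have eq: "n = v" if "?P v" "\<forall>m<v. \<not> ?P m"
    unfolding n_def using that by (intro Least_equality) (blast, meson not_le)
  have *: "ev N xs (Mu p) ns = (if n < N \<and> ev N xs p (n # ns) = 1 then Suc n else 0)"
    by (simp add: n_def Let_def)
  show ?thesis
  proof
    assume "ev N xs (Mu p) ns = Suc v"
    with * have "n < N" "ev N xs p (n # ns) = 1" "n = v" by (simp_all split: if_splits)
    then show "v < N \<and> ev N xs p (v # ns) = 1 \<and> (\<forall>m<v. 1 < ev N xs p (m # ns))"
      using less by (simp add: not_le)
  next
    assume v: "v < N \<and> ev N xs p (v # ns) = 1 \<and> (\<forall>m<v. 1 < ev N xs p (m # ns))"
    then have "n = v" by (intro eq) (auto simp: not_le)
    with * v show "ev N xs (Mu p) ns = Suc v" by simp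
  qed
qed

lemma ev_sound: "ev N xs p ns = Suc v \<Longrightarrow> eval xs p ns v"
proof (induction p arbitrary: ns v)
  case Zero
  then show ?case by (auto intro: eval_Zero)
next
  case Succ
  then show ?case by (auto simp: length_Suc_conv intro: eval_Succ split: if_splits)
next
  case (Proj i)
  then show ?case by (auto intro: eval_Proj split: if_splits)
next
  case (Oracle i)
  then show ?case by (auto simp: length_Suc_conv intro: eval_Oracle split: if_splits)
next
  case (Comp p qs)
  have nz: "\<forall>q\<in>set qs. ev N xs q ns \<noteq> 0" and p: "ev N xs p (map (\<lambda>q. ev N xs q ns - 1) qs) = Suc v"
    using Comp.prems by (auto split: if_splits)
  have "list_all2 (\<lambda>q u. eval xs q ns u) qs (map (\<lambda>q. ev N xs q ns - 1) qs)"
    using nz by (auto simp: list_all2_conv_all_nth intro!: Comp.IH(2)[OF nth_mem])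
  then show ?case using Comp.IH(1)[OF p] by (rule eval_Comp)
next
  case (Prec p q)
  then obtain n ms where ns: "ns = n # ms" by (cases ns) auto
  have "rec_nat (ev N xs p ms) (\<lambda>i u. if u = 0 then 0 else ev N xs q (i # (u - 1) # ms)) n = Suc v
      \<Longrightarrow> eval xs (Prec p q) (n # ms) v"
  proof (induction n arbitrary: v)
    case 0
    then show ?case by (auto intro: eval_Prec_0 Prec.IH(1))
  next
    case (Suc n)
    define w where "w = rec_nat (ev N xs p ms) (\<lambda>i u. if u = 0 then 0 else ev N xs q (i # (u - 1) # ms)) n"
    have w: "w = Suc (w - 1)" "ev N xs q (n # (w - 1) # ms) = Suc v"
      using Suc.prems by (auto simp: w_def[symmetric] split: if_splits)
    have "eval xs (Prec p q) (n # ms) (w - 1)" using Suc.IH w(1) unfolding w_def by blast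
    then show ?case using Prec.IH(2)[OF w(2)] by (rule eval_Prec_Suc)
  qed
  then show ?case using Prec.prems ns by simp
next
  case (Mu p)
  show ?case
  proof (rule eval_Mu)
    have *: "ev N xs p (v # ns) = 1" "\<forall>m<v. 1 < ev N xs p (m # ns)"
      using Mu.prems unfolding ev_Mu_eq_Suc by simp_all
    show "eval xs p (v # ns) 0" by (rule Mu.IH) (simp add: *)
    show "\<forall>m<v. \<exists>k. eval xs p (m # ns) (Suc k)"
    proof (intro allI impI)
      fix m assume "m < v"
      then have "ev N xs p (m # ns) = Suc (Suc (ev N xs p (m # ns) - 2))" using *(2) by fastforce
      then show "\<exists>k. eval xs p (m # ns) (Suc k)" using Mu.IH by blast
    qed
  qed
qed

text \<open>A successful bounded evaluation queries its oracles only below \<open>N\<close>, so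
  agreement there suffices. This is what lets finite initial segments stand for reals in the trees
  below.\<close>

lemma ev_mono:
  assumes le: "N \<le> M" and len: "length ys = length xs"
    and agree: "\<And>i n. i < length xs \<Longrightarrow> n < N \<Longrightarrow> (xs ! i) n = (ys ! i) n"
  shows "ev N xs p ns = Suc v \<Longrightarrow> ev M ys p ns = Suc v"
proof (induction p arbitrary: ns v)
  case (Oracle i)
  then show ?case using le len agree by (auto split: if_splits)
next
  case (Comp p qs)
  have nz: "\<forall>q\<in>set qs. ev N xs q ns \<noteq> 0" and p: "ev N xs p (map (\<lambda>q. ev N xs q ns - 1) qs) = Suc v"
    using Comp.prems by (auto split: if_splits)
  have eq: "ev M ys q ns = ev N xs q ns" if "q \<in> set qs" for q
    using Comp.IH(2)[OF that, of ns "ev N xs q ns - 1"] nz that by auto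
  have "map (\<lambda>q. ev M ys q ns - 1) qs = map (\<lambda>q. ev N xs q ns - 1) qs" using eq by simp
  then show ?case using Comp.IH(1)[OF p] eq nz by (simp del: map_eq_conv)
next
  case (Prec p q)
  then obtain n ms where ns: "ns = n # ms" by (cases ns) auto
  have "rec_nat (ev N xs p ms) (\<lambda>i u. if u = 0 then 0 else ev N xs q (i # (u - 1) # ms)) n = Suc v
      \<Longrightarrow> rec_nat (ev M ys p ms) (\<lambda>i u. if u = 0 then 0 else ev M ys q (i # (u - 1) # ms)) n = Suc v"
    by (induction n arbitrary: v) (auto simp: Prec.IH gr0_conv_Suc split: if_splits)
  then show ?case using Prec.prems ns by simp
next
  case (Mu p)
  have *: "v < N" "ev N xs p (v # ns) = Suc 0" "\<forall>m<v. 1 < ev N xs p (m # ns)"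
    using Mu.prems unfolding ev_Mu_eq_Suc by simp_all
  have "1 < ev M ys p (m # ns)" if "m < v" for m
    using *(3) that Mu.IH[of "m # ns" "ev N xs p (m # ns) - 1"] by fastforce
  then show ?case using * le Mu.IH[OF *(2)] unfolding ev_Mu_eq_Suc by simp
qed auto

lemma ev_mono_bound: "ev N xs p ns = Suc v \<Longrightarrow> N \<le> M \<Longrightarrow> ev M xs p ns = Suc v"
  by (rule ev_mono) simp_all

lemma ev_complete: "eval xs p ns v \<Longrightarrow> \<exists>N. ev N xs p ns = Suc v"
proof (induction rule: eval.induct)
  case (eval_Oracle i n)
  then show ?case by (intro exI[of _ "Suc n"]) simp
next
  case (eval_Comp ns qs us p v)
  have len: "length us = length qs" using eval_Comp.IH(1) by (simp add: list_all2_lengthD)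
  have "\<forall>i<length qs. \<exists>N. ev N xs (qs ! i) ns = Suc (us ! i)"
    using eval_Comp.IH(1) by (auto simp: list_all2_conv_all_nth)
  then obtain f where f: "\<And>i. i < length qs \<Longrightarrow> ev (f i) xs (qs ! i) ns = Suc (us ! i)" by metis
  obtain K where K: "ev K xs p us = Suc v" using eval_Comp.IH(2) by blast
  define M where "M = Max (insert K (f ` {..<length qs}))"
  have M: "K \<le> M" "\<And>i. i < length qs \<Longrightarrow> f i \<le> M" by (simp_all add: M_def)
  have q: "ev M xs (qs ! i) ns = Suc (us ! i)" if "i < length qs" for i
    using ev_mono_bound[OF f[OF that] M(2)[OF that]] .
  have "\<forall>q\<in>set qs. ev M xs q ns \<noteq> 0" using q by (metis in_set_conv_nth nat.distinct(1))
  moreover have "map (\<lambda>q. ev M xs q ns - 1) qs = us"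
    by (rule nth_equalityI) (simp_all add: len q)
  ultimately have "ev M xs (Comp p qs) ns = Suc v" using ev_mono_bound[OF K M(1)] by simp
  then show ?case ..
next
  case (eval_Prec_0 p ns v q)
  then show ?case by auto
next
  case (eval_Prec_Suc p q n ns u v)
  then obtain N M where NM: "ev N xs (Prec p q) (n # ns) = Suc u" "ev M xs q (n # u # ns) = Suc v"
    by blast
  have "ev (max N M) xs (Prec p q) (n # ns) = Suc u" "ev (max N M) xs q (n # u # ns) = Suc v"
    by (rule ev_mono_bound[OF NM(1)], simp, rule ev_mono_bound[OF NM(2)], simp)
  then have "ev (max N M) xs (Prec p q) (Suc n # ns) = Suc v" by simp
  then show ?case ..
next
  case (eval_Mu p n ns)
  have "\<forall>m. \<exists>N. m < n \<longrightarrow> (\<exists>k. ev N xs p (m # ns) = Suc (Suc k))" using eval_Mu.IH(2) by blast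
  then obtain f where f: "\<And>m. m < n \<Longrightarrow> \<exists>k. ev (f m) xs p (m # ns) = Suc (Suc k)" by metis
  obtain K where K: "ev K xs p (n # ns) = Suc 0" using eval_Mu.IH(1) by blast
  define M where "M = Max (insert (Suc n) (insert K (f ` {..<n})))"
  have ge: "x \<le> M" if "x \<in> insert (Suc n) (insert K (f ` {..<n}))" for x
    unfolding M_def using that by (intro Max_ge) auto
  have M: "n < M" "K \<le> M" "\<And>i. i < n \<Longrightarrow> f i \<le> M"
    using ge[of "Suc n"] ge by (simp_all add: Suc_le_eq)
  have "1 < ev M xs p (m # ns)" if m: "m < n" for m
  proof -
    obtain k where "ev (f m) xs p (m # ns) = Suc (Suc k)" using f[OF m] by blast
    from ev_mono_bound[OF this M(3)[OF m]] show ?thesis by simp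
  qed
  then have "ev M xs (Mu p) ns = Suc n"
    unfolding ev_Mu_eq_Suc using ev_mono_bound[OF K M(2)] M(1) by simp
  then show ?case ..
qed (auto simp del: One_nat_def)

lemma eval_iff_ev: "eval xs p ns v \<longleftrightarrow> (\<exists>N. ev N xs p ns = Suc v)"
  using ev_sound ev_complete by blast

section \<open>Computability of bounded evaluation, and substitution for oracles\<close>

lemma decp_const [cintros]: "decp D (\<lambda>c r. b)"
  unfolding decp_def by (rule cfun_const)

text \<open>Oracles that are themselves computable from \<open>D r\<close>, uniformly in the
  parameter \<open>c\<close>; the argument of an oracle is packed in front of
  \<open>c\<close>.\<close>

definition coracles ::
    "('r \<Rightarrow> (nat \<Rightarrow> nat) list) \<Rightarrow> nat \<Rightarrow> (nat \<Rightarrow> 'r \<Rightarrow> (nat \<Rightarrow> nat) list) \<Rightarrow> bool" where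
  "coracles D L X \<longleftrightarrow> (\<forall>c r. length (X c r) = L)
    \<and> (\<forall>i<L. cfun D (\<lambda>c r. (X (psnd c) r ! i) (pfst c)))"

lemma coracles_comp:
  assumes "coracles D L X" "cfun D t" shows "coracles D L (\<lambda>c r. X (t c r) r)"
  unfolding coracles_def
proof (intro conjI allI impI)
  fix i assume "i < L"
  then have *: "cfun D (\<lambda>c r. (X (psnd c) r ! i) (pfst c))" using assms(1) by (simp add: coracles_def)
  have "cfun D (\<lambda>c r. pair (pfst c) (t (psnd c) r))"
    by (intro cintros cfun_comp[OF assms(2)])
  from cfun_comp[OF * this] show "cfun D (\<lambda>c r. (X (t (psnd c) r) r ! i) (pfst c))" by simp
qed (use assms in \<open>simp add: coracles_def\<close>)

lemma list_decode_case:
  "list_decode a = (if a = 0 then [] else pfst (a - 1) # list_decode (psnd (a - 1)))"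
  by (cases a) (auto simp: pfst_def psnd_def split: prod.splits)

text \<open>The program is fixed, so structural induction on it replaces a universal machine. Bound,
  oracles and input are arbitrary because recursion and minimisation evaluate subprograms with a
  larger packed parameter.\<close>

lemma cfun_ev:
  assumes "cfun D N" "coracles D L X" "cfun D a"
  shows "cfun D (\<lambda>c r. ev (N c r) (X c r) p (list_decode (a c r)))"
  using assms
proof (induction p arbitrary: N X a)
  case Zero
  show ?case by (simp only: ev.simps) (intro cintros)
next
  case Succ
  have "hd s = ext s 0" if "length s = 1" for s
    using that by (auto simp: length_Suc_conv ext_def)
  then have "ev N xs Succ ns = (if length ns = 1 then Suc (Suc (ext ns 0)) else 0)" for N xs ns
    by simp
  then show ?case using Succ by (simp only:) (intro cintros)
next
  case (Proj i)
  have "ev N xs (Proj i) ns = (if i < length ns then Suc (ext ns (length ns - Suc i)) else 0)" for N xs ns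
    by (auto simp: ext_def rev_nth)
  then show ?case using Proj by (simp only:) (intro cintros)
next
  case (Oracle i)
  have hd: "hd s = ext s 0" if "length s = 1" for s
    using that by (auto simp: length_Suc_conv ext_def)
  show ?case
  proof (cases "i < L")
    case True
    have "cfun D (\<lambda>c r. (X (psnd c) r ! i) (pfst c))"
      using Oracle.prems(2) True by (simp add: coracles_def)
    moreover have "cfun D (\<lambda>c r. pair (ext (list_decode (a c r)) 0) c)"
      using Oracle.prems by (intro cintros)
    ultimately have *: "cfun D (\<lambda>c r. (X c r ! i) (ext (list_decode (a c r)) 0))"
      by (auto dest: cfun_comp)
    have "ev (N c r) (X c r) (Oracle i) (list_decode (a c r))
      = (if length (list_decode (a c r)) = 1 \<and> ext (list_decode (a c r)) 0 < N c r
         then Suc ((X c r ! i) (ext (list_decode (a c r)) 0)) else 0)" for c r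
      using True Oracle.prems(2) hd by (auto simp: coracles_def)
    then show ?thesis using * Oracle.prems by (simp only:) (intro cintros)
  next
    case False
    then have "ev (N c r) (X c r) (Oracle i) ns = 0" for c r ns
      using Oracle.prems(2) by (simp add: coracles_def)
    then show ?thesis by (simp only:) (intro cintros)
  qed
next
  case (Comp p qs)
  let ?u = "\<lambda>q c r. ev (N c r) (X c r) q (list_decode (a c r))"
  have q: "cfun D (?u q)" if "q \<in> set qs" for q
    using Comp.IH(2)[OF that] Comp.prems by blast
  then have us: "cfun D (\<lambda>c r. list_encode (map (\<lambda>q. ?u q c r - 1) qs))"
  proof (induction qs)
    case Nil
    show ?case by (simp add: cfun_const)
  next
    case (Cons q qs)
    then have "cfun D (\<lambda>c r. Suc (pair (?u q c r - 1) (list_encode (map (\<lambda>q. ?u q c r - 1) qs))))"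
      by (intro cintros) auto
    then show ?case by simp
  qed
  have z: "decp D (\<lambda>c r. \<exists>q\<in>set qs. ?u q c r = 0)"
    using q
  proof (induction qs)
    case Nil
    show ?case by (simp add: decp_const)
  next
    case (Cons q qs)
    then have "decp D (\<lambda>c r. ?u q c r = 0 \<or> (\<exists>q\<in>set qs. ?u q c r = 0))" by (intro cintros) auto
    then show ?case by simp
  qed
  have "cfun D (\<lambda>c r. ev (N c r) (X c r) p (list_decode (list_encode (map (\<lambda>q. ?u q c r - 1) qs))))"
    using Comp.IH(1)[OF Comp.prems(1,2) us] .
  then show ?case using z by (simp only: ev.simps list_encode_inverse) (intro cintros)
next
  case (Prec p q)
  let ?m = "\<lambda>c r. psnd (a c r - 1)"
  have m: "cfun D ?m" using Prec.prems(3) by (intro cintros)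
  have p: "cfun D (\<lambda>c r. ev (N c r) (X c r) p (list_decode (?m c r)))"
    using Prec.IH(1)[OF Prec.prems(1,2) m] .
  have t: "cfun D (\<lambda>c r. psnd (psnd c))" by (intro cintros)
  have e: "list_decode (Suc (pair i (Suc (pair u m)))) = i # u # list_decode m" for i u m by simp
  have "cfun D (\<lambda>c r. ev (N (psnd (psnd c)) r) (X (psnd (psnd c)) r) q
    (list_decode (Suc (pair (pfst c) (Suc (pair (pfst (psnd c) - 1) (?m (psnd (psnd c)) r)))))))"
    by (intro Prec.IH(2) cfun_comp[OF Prec.prems(1) t] coracles_comp[OF Prec.prems(2) t] cintros
        cfun_comp[OF m t])
  then have q: "cfun D (\<lambda>c r. ev (N (psnd (psnd c)) r) (X (psnd (psnd c)) r) q
    (pfst c # (pfst (psnd c) - 1) # list_decode (?m (psnd (psnd c)) r)))"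
    unfolding e .
  have "cfun D (\<lambda>c r. rec_nat (ev (N c r) (X c r) p (list_decode (?m c r)))
     (\<lambda>i u. if u = 0 then 0 else ev (N c r) (X c r) q (i # (u - 1) # list_decode (?m c r))) (pfst (a c r - 1)))"
    using p q Prec.prems(3) by (intro cintros)
  then have "cfun D (\<lambda>c r. if a c r = 0 then 0 else rec_nat (ev (N c r) (X c r) p (list_decode (?m c r)))
     (\<lambda>i u. if u = 0 then 0 else ev (N c r) (X c r) q (i # (u - 1) # list_decode (?m c r))) (pfst (a c r - 1)))"
    by (intro cfun_If[OF _ cfun_const] decp_eq Prec.prems(3) cfun_const)
  moreover have "ev (N c r) (X c r) (Prec p q) (list_decode (a c r)) = (if a c r = 0 then 0 else
    rec_nat (ev (N c r) (X c r) p (list_decode (?m c r)))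
     (\<lambda>i u. if u = 0 then 0 else ev (N c r) (X c r) q (i # (u - 1) # list_decode (?m c r))) (pfst (a c r - 1)))"
    for c r
    by (simp add: list_decode_case[of "a c r"] del: One_nat_def list_decode.simps)
  ultimately show ?case by simp
next
  case (Mu p)
  have t: "cfun D (\<lambda>c r. psnd c)" by (intro cintros)
  have e: "list_decode (Suc (pair n m)) = n # list_decode m" for n m by simp
  have "cfun D (\<lambda>c r. ev (N (psnd c) r) (X (psnd c) r) p (list_decode (Suc (pair (pfst c) (a (psnd c) r)))))"
    by (intro Mu.IH cfun_comp[OF Mu.prems(1) t] coracles_comp[OF Mu.prems(2) t] cintros
        cfun_comp[OF Mu.prems(3) t])
  then have p: "cfun D (\<lambda>c r. ev (N (psnd c) r) (X (psnd c) r) p (pfst c # list_decode (a (psnd c) r)))"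
    unfolding e .
  have n: "cfun D (\<lambda>c r. LEAST n. N c r \<le> n \<or> ev (N c r) (X c r) p (n # list_decode (a c r)) \<le> 1)"
    (is "cfun D ?n")
  proof (rule cfun_Least)
    show "decp D (\<lambda>c r. N (psnd c) r \<le> pfst c
        \<or> ev (N (psnd c) r) (X (psnd c) r) p (pfst c # list_decode (a (psnd c) r)) \<le> 1)"
      using p cfun_comp[OF Mu.prems(1) t] by (intro cintros)
  qed auto
  have "cfun D (\<lambda>c r. pair (?n c r) c)" using n by (intro cintros)
  from cfun_comp[OF p this] have "cfun D (\<lambda>c r. ev (N c r) (X c r) p (?n c r # list_decode (a c r)))"
    by simp
  then show ?case using n Mu.prems(1) by (simp only: ev.simps Let_def) (intro cintros)
qed

text \<open>The bound of the evaluator is raised until it suffices, which happens eventually because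
  the program for \<open>F\<close> halts with the oracles \<open>D r\<close> for every
  \<open>r\<close>.\<close>

lemma cfun_subst:
  assumes F: "cfun D F" and len: "\<And>r. length (D r) = L" and H: "cfun D' H"
    and \<sigma>: "\<And>i. i < L \<Longrightarrow> cfun D' (\<lambda>c r. (D (\<sigma> (psnd c) r) ! i) (pfst c))"
  shows "cfun D' (\<lambda>c r. F (H c r) (\<sigma> c r))"
proof -
  obtain p where p: "\<And>c r. eval (D r) p [c] (F c r)" using F by (rule cfunE) blast
  have X: "coracles D' L (\<lambda>c r. D (\<sigma> c r))" using len \<sigma> by (simp add: coracles_def)
  have t: "cfun D' (\<lambda>c r. psnd c)" by (intro cintros)
  have e: "list_decode (Suc (pair n 0)) = [n]" for n by simp
  have "cfun D' (\<lambda>c r. ev (pfst c) (D (\<sigma> (psnd c) r)) p (list_decode (Suc (pair (H (psnd c) r) 0))))"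
    by (intro cfun_ev[where L = L] coracles_comp[OF X t] cintros cfun_comp[OF H t])
  then have c: "cfun D' (\<lambda>c r. ev (pfst c) (D (\<sigma> (psnd c) r)) p [H (psnd c) r])"
    unfolding e .
  let ?N = "\<lambda>c r. LEAST N. ev N (D (\<sigma> c r)) p [H c r] \<noteq> 0"
  have ex: "\<exists>N. ev N (D (\<sigma> c r)) p [H c r] \<noteq> 0" for c r
    using ev_complete[OF p] by (metis nat.distinct(1))
  have "cfun D' ?N" using c ex by (intro cfun_Least decp_nonzero)
  then have "cfun D' (\<lambda>c r. pair (?N c r) c)" by (intro cintros)
  from cfun_comp[OF c this] have "cfun D' (\<lambda>c r. ev (?N c r) (D (\<sigma> c r)) p [H c r])" by simp
  then have "cfun D' (\<lambda>c r. ev (?N c r) (D (\<sigma> c r)) p [H c r] - 1)" by (intro cintros)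
  moreover have "ev (?N c r) (D (\<sigma> c r)) p [H c r] - 1 = F (H c r) (\<sigma> c r)" for c r
  proof -
    have "ev (?N c r) (D (\<sigma> c r)) p [H c r] \<noteq> 0" using ex by (rule LeastI_ex)
    then obtain v where v: "ev (?N c r) (D (\<sigma> c r)) p [H c r] = Suc v" by (cases "ev (?N c r) (D (\<sigma> c r)) p [H c r]") auto
    from ev_sound[OF v] p have "v = F (H c r) (\<sigma> c r)" by (rule eval_deterministic)
    with v show ?thesis by simp
  qed
  ultimately show ?thesis by simp
qed

lemma decp_subst:
  assumes "decp D P" "\<And>r. length (D r) = L" "cfun D' H"
    and "\<And>i. i < L \<Longrightarrow> cfun D' (\<lambda>c r. (D (\<sigma> (psnd c) r) ! i) (pfst c))"
  shows "decp D' (\<lambda>c r. P (H c r) (\<sigma> c r))"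
  using cfun_subst[OF _ assms(2-4)] assms(1) unfolding decp_def by blast

lemma decp_single_subst:
  assumes "decp single P" "cfun D H" "cfun D (\<lambda>c r. G (pfst c) (psnd c) r)"
  shows "decp D (\<lambda>c r. P (H c r) (\<lambda>i. G i c r))"
  by (rule decp_subst[OF assms(1), where L = 1]) (use assms in \<open>simp_all add: single_def\<close>)

section \<open>The class \<open>\<Sigma>\<^sup>1\<^sub>1\<close>\<close>

lemma cfun_single_subst:
  assumes "cfun single F" "cfun D H" "cfun D (\<lambda>c r. G (pfst c) (psnd c) r)"
  shows "cfun D (\<lambda>c r. F (H c r) (\<lambda>i. G i c r))"
  by (rule cfun_subst[OF assms(1), where L = 1]) (use assms in \<open>simp_all add: single_def\<close>)

definition join :: "(nat \<Rightarrow> nat) \<Rightarrow> (nat \<Rightarrow> nat) \<Rightarrow> nat \<Rightarrow> nat" where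
  "join y z = (\<lambda>i. if even i then y (i div 2) else z (i div 2))"

lemma join_even [simp]: "join y z (2 * i) = y i" by (simp add: join_def)
lemma join_odd [simp]: "join y z (Suc (2 * i)) = z i" by (simp add: join_def)
lemma join_0 [simp]: "join y z 0 = y 0" by (simp add: join_def)

text \<open>
  \<open>sigma\<close> is the class \<open>\<Sigma>\<^sup>1\<^sub>1\<close> on \<open>\<nat> \<times> \<nat>\<^sup>\<nat>\<close>; further number arguments are packed by
  \<^const>\<open>prod_encode\<close>, further real arguments by \<^const>\<open>join\<close>.
\<close>

definition sigma :: "(nat \<Rightarrow> (nat \<Rightarrow> nat) \<Rightarrow> bool) \<Rightarrow> bool" where
  "sigma \<phi> \<longleftrightarrow> (\<exists>\<psi>. decp single \<psi> \<and> (\<forall>c z. \<phi> c z \<longleftrightarrow> (\<exists>y. \<forall>m. \<psi> (pair m c) (join y z))))"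

named_theorems sintros

lemma sigmaE:
  assumes "sigma \<phi>"
  obtains \<psi> where "decp single \<psi>" "\<And>c z. \<phi> c z \<longleftrightarrow> (\<exists>y. \<forall>m. \<psi> (pair m c) (join y z))"
  using assms unfolding sigma_def by blast

lemma sigmaI:
  "decp single \<psi> \<Longrightarrow> (\<And>c z. \<phi> c z \<longleftrightarrow> (\<exists>y. \<forall>m. \<psi> (pair m c) (join y z))) \<Longrightarrow> sigma \<phi>"
  unfolding sigma_def by blast

lemma sigma_dec:
  assumes "decp single P" shows "sigma P"
proof (rule sigmaI)
  show "decp single (\<lambda>c z. P (psnd c) (\<lambda>i. z (Suc (2 * i))))"
    by (intro decp_single_subst[OF assms] cintros)
qed simp

text \<open>The witness at the even positions stays untouched; only the odd positions, which hold
  the real argument, are recomputed.\<close>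

lemma sigma_subst:
  assumes "sigma \<phi>" "cfun single H" "cfun single (\<lambda>c z. G (pfst c) (psnd c) z)"
  shows "sigma (\<lambda>c z. \<phi> (H c z) (\<lambda>i. G i c z))"
proof -
  obtain \<psi> where \<psi>: "decp single \<psi>" "\<And>c z. \<phi> c z \<longleftrightarrow> (\<exists>y. \<forall>m. \<psi> (pair m c) (join y z))"
    using assms(1) by (rule sigmaE) blast
  have H: "cfun single (\<lambda>c z. H (psnd c) (\<lambda>i. z (Suc (2 * i))))"
    by (intro cfun_single_subst[OF assms(2)] cintros)
  have "cfun single (\<lambda>c z. G (pfst (pair (pfst c div 2) (psnd (psnd c))))
      (psnd (pair (pfst c div 2) (psnd (psnd c)))) (\<lambda>i. z (Suc (2 * i))))"
    by (intro cfun_single_subst[OF assms(3)] cintros)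
  then have G: "cfun single (\<lambda>c z. G (pfst c div 2) (psnd (psnd c)) (\<lambda>i. z (Suc (2 * i))))"
    by simp
  show ?thesis
  proof (rule sigmaI)
    show "decp single (\<lambda>c z. \<psi> (pair (pfst c) (H (psnd c) (\<lambda>i. z (Suc (2 * i)))))
       (\<lambda>i. if even i then z i else G (i div 2) (psnd c) (\<lambda>i. z (Suc (2 * i)))))"
      using H G by (intro decp_single_subst[OF \<psi>(1)] cintros)
    have "(\<lambda>i. if even i then join y z i else G (i div 2) c z) = join y (\<lambda>i. G i c z)" for c y z
      by (auto simp: join_def)
    then show "\<phi> (H c z) (\<lambda>i. G i c z) \<longleftrightarrow> (\<exists>y. \<forall>m. \<psi> (pair (pfst (pair m c)) (H (psnd (pair m c))
        (\<lambda>i. join y z (Suc (2 * i)))))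
       (\<lambda>i. if even i then join y z i else G (i div 2) (psnd (pair m c)) (\<lambda>i. join y z (Suc (2 * i)))))" for c z
      by (simp add: \<psi>(2) cong: if_cong)
  qed
qed

lemma sigma_comp:
  assumes "sigma \<phi>" "cfun single H" shows "sigma (\<lambda>c z. \<phi> (H c z) z)"
  by (intro sigma_subst[OF assms, where G = "\<lambda>i c z. z i"] cintros)

text \<open>The number is stored as the first value of the witness, whose tail then serves the
  matrix.\<close>

lemma sigma_ex [sintros]:
  assumes "sigma (\<lambda>c z. \<phi> (pfst c) (psnd c) z)"
  shows "sigma (\<lambda>c z. \<exists>n. \<phi> n c z)"
proof -
  obtain \<psi> where \<psi>: "decp single \<psi>"
    "\<And>c z. \<phi> (pfst c) (psnd c) z \<longleftrightarrow> (\<exists>y. \<forall>m. \<psi> (pair m c) (join y z))"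
    using assms by (rule sigmaE) blast
  have 1: "\<phi> n c z \<longleftrightarrow> (\<exists>y. \<forall>m. \<psi> (pair m (pair n c)) (join y z))" for n c z
    using \<psi>(2)[of "pair n c" z] by simp
  have 2: "(\<lambda>i. if even i then join y z (2 * Suc (i div 2)) else join y z i) = join (\<lambda>i. y (Suc i)) z" for y z
    unfolding join_even by (auto simp: join_def)
  show ?thesis
  proof (rule sigmaI)
    show "decp single (\<lambda>c z. \<psi> (pair (pfst c) (pair (z 0) (psnd c)))
       (\<lambda>i. if even i then z (2 * Suc (i div 2)) else z i))"
      by (intro decp_single_subst[OF \<psi>(1)] cintros)
    show "(\<exists>n. \<phi> n c z) \<longleftrightarrow> (\<exists>y. \<forall>m. \<psi> (pair (pfst (pair m c)) (pair (join y z 0) (psnd (pair m c))))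
       (\<lambda>i. if even i then join y z (2 * Suc (i div 2)) else join y z i))" for c z
    proof -
      have "(\<exists>n y. \<forall>m. \<psi> (pair m (pair n c)) (join y z))
        \<longleftrightarrow> (\<exists>y. \<forall>m. \<psi> (pair m (pair (y 0) c)) (join (\<lambda>i. y (Suc i)) z))" (is "?L \<longleftrightarrow> ?R")
      proof
        assume ?L
        then obtain n y where "\<forall>m. \<psi> (pair m (pair n c)) (join y z)" by blast
        then show ?R by (intro exI[of _ "case_nat n y"]) simp
      qed blast
      then show ?thesis unfolding 1 2 by simp
    qed
  qed
qed

text \<open>Countable choice: one real holds the witnesses for all \<open>n\<close>, the one for
  \<open>n\<close> at the positions \<open>pair n i\<close>, and the two universal number
  quantifiers merge into one.\<close>

lemma sigma_all [sintros]:
  assumes "sigma (\<lambda>c z. \<phi> (pfst c) (psnd c) z)"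
  shows "sigma (\<lambda>c z. \<forall>n. \<phi> n c z)"
proof -
  obtain \<psi> where \<psi>: "decp single \<psi>"
    "\<And>c z. \<phi> (pfst c) (psnd c) z \<longleftrightarrow> (\<exists>y. \<forall>m. \<psi> (pair m c) (join y z))"
    using assms by (rule sigmaE) blast
  have 1: "\<phi> n c z \<longleftrightarrow> (\<exists>y. \<forall>m. \<psi> (pair m (pair n c)) (join y z))" for n c z
    using \<psi>(2)[of "pair n c" z] by simp
  have 2: "(\<lambda>i. if even i then join y z (2 * pair n (i div 2)) else join y z i)
      = join (\<lambda>i. y (pair n i)) z" for y z n
    unfolding join_even by (auto simp: join_def)
  show ?thesis
  proof (rule sigmaI)
    show "decp single (\<lambda>c z. \<psi> (pair (psnd (pfst c)) (pair (pfst (pfst c)) (psnd c)))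
       (\<lambda>i. if even i then z (2 * pair (pfst (pfst c)) (i div 2)) else z i))"
      by (intro decp_single_subst[OF \<psi>(1)] cintros)
    show "(\<forall>n. \<phi> n c z) \<longleftrightarrow> (\<exists>y. \<forall>m. \<psi> (pair (psnd (pfst (pair m c)))
        (pair (pfst (pfst (pair m c))) (psnd (pair m c))))
       (\<lambda>i. if even i then join y z (2 * pair (pfst (pfst (pair m c))) (i div 2)) else join y z i))" for c z
    proof -
      have "(\<forall>n. \<exists>y. \<forall>m. \<psi> (pair m (pair n c)) (join y z))
        \<longleftrightarrow> (\<exists>y. \<forall>k. \<psi> (pair (psnd k) (pair (pfst k) c)) (join (\<lambda>i. y (pair (pfst k) i)) z))"
        (is "?L \<longleftrightarrow> ?R")
      proof
        assume ?L
        then obtain y where "\<forall>n m. \<psi> (pair m (pair n c)) (join (y n) z)" by metis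
        then show ?R by (intro exI[of _ "\<lambda>i. y (pfst i) (psnd i)"]) simp
      next
        assume ?R
        then obtain y where y: "\<psi> (pair (psnd k) (pair (pfst k) c)) (join (\<lambda>i. y (pair (pfst k) i)) z)" for k
          by blast
        have "\<psi> (pair m (pair n c)) (join (\<lambda>i. y (pair n i)) z)" for m n
          using y[of "pair n m"] by simp
        then show ?L by blast
      qed
      then show ?thesis unfolding 1 2 by simp
    qed
  qed
qed

text \<open>Two witnesses merge by \<open>join\<close>; what remains is the reassociation of
  \<open>join (join w y) z\<close> to \<open>join w (join y z)\<close>.\<close>

lemma sigma_ex_real [sintros]:
  assumes "sigma (\<lambda>c z. \<phi> (\<lambda>i. z (2 * i)) c (\<lambda>i. z (Suc (2 * i))))"
  shows "sigma (\<lambda>c z. \<exists>y. \<phi> y c z)"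
proof -
  obtain \<psi> where \<psi>: "decp single \<psi>"
    "\<And>c z. \<phi> (\<lambda>i. z (2 * i)) c (\<lambda>i. z (Suc (2 * i))) \<longleftrightarrow> (\<exists>y. \<forall>m. \<psi> (pair m c) (join y z))"
    using assms by (rule sigmaE) blast
  have 1: "\<phi> y c z \<longleftrightarrow> (\<exists>w. \<forall>m. \<psi> (pair m c) (join w (join y z)))" for y c z
    using \<psi>(2)[of "join y z" c] by simp
  have 2: "(\<lambda>i. if even i then join (join w y) z (2 * i)
      else if even (i div 2) then join (join w y) z (2 * Suc (2 * (i div 2 div 2)))
      else join (join w y) z (Suc (2 * (i div 2 div 2)))) = join w (join y z)" for w y z
    unfolding join_even join_odd by (auto simp: join_def)
  show ?thesis
  proof (rule sigmaI)
    show "decp single (\<lambda>c z. \<psi> c (\<lambda>i. if even i then z (2 * i)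
      else if even (i div 2) then z (2 * Suc (2 * (i div 2 div 2))) else z (Suc (2 * (i div 2 div 2)))))"
      by (intro decp_single_subst[OF \<psi>(1)] cintros)
    show "(\<exists>y. \<phi> y c z) \<longleftrightarrow> (\<exists>y. \<forall>m. \<psi> (pair m c) (\<lambda>i. if even i then join y z (2 * i)
      else if even (i div 2) then join y z (2 * Suc (2 * (i div 2 div 2)))
      else join y z (Suc (2 * (i div 2 div 2)))))" (is "_ \<longleftrightarrow> ?R") for c z
    proof
      assume "\<exists>y. \<phi> y c z"
      then obtain y w where "\<forall>m. \<psi> (pair m c) (join w (join y z))" unfolding 1 by blast
      then show ?R by (intro exI[of _ "join w y"]) (simp only: 2 simp_thms)
    next
      assume ?R
      then obtain u where u: "\<forall>m. \<psi> (pair m c) (\<lambda>i. if even i then join u z (2 * i)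
        else if even (i div 2) then join u z (2 * Suc (2 * (i div 2 div 2)))
        else join u z (Suc (2 * (i div 2 div 2))))" by blast
      have "u = join (\<lambda>i. u (2 * i)) (\<lambda>i. u (Suc (2 * i)))"
        by (rule ext) (simp add: join_def)
      then obtain w y where "u = join w y" by blast
      with u have "\<forall>m. \<psi> (pair m c) (join w (join y z))" by (simp only: 2 simp_thms)
      then show "\<exists>y. \<phi> y c z" unfolding 1 by blast
    qed
  qed
qed

text \<open>The first value of the witness names the disjunct that its tail proves.\<close>

lemma sigma_disj [sintros]:
  assumes "sigma P" "sigma Q" shows "sigma (\<lambda>c z. P c z \<or> Q c z)"
proof -
  obtain \<psi> where \<psi>: "decp single \<psi>" "\<And>c z. P c z \<longleftrightarrow> (\<exists>y. \<forall>m. \<psi> (pair m c) (join y z))"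
    using assms(1) by (rule sigmaE) blast
  obtain \<chi> where \<chi>: "decp single \<chi>" "\<And>c z. Q c z \<longleftrightarrow> (\<exists>y. \<forall>m. \<chi> (pair m c) (join y z))"
    using assms(2) by (rule sigmaE) blast
  define t where "t z = (\<lambda>i. if even i then z (2 * Suc (i div 2)) else z i)" for z :: "nat \<Rightarrow> nat"
  have t: "t (join y z) = join (\<lambda>i. y (Suc i)) z" for y z
    unfolding t_def join_even by (auto simp: join_def)
  show ?thesis
  proof (rule sigmaI)
    have "decp single (\<lambda>c z. \<psi> c (t z))" "decp single (\<lambda>c z. \<chi> c (t z))" unfolding t_def
      by (intro decp_single_subst[OF \<psi>(1)] decp_single_subst[OF \<chi>(1)] cintros)+
    then show "decp single (\<lambda>c z. (z 0 = 0 \<longrightarrow> \<psi> c (t z)) \<and> (z 0 = 0 \<or> \<chi> c (t z)))"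
      by (intro cintros)
    show "P c z \<or> Q c z \<longleftrightarrow> (\<exists>y. \<forall>m. (join y z 0 = 0 \<longrightarrow> \<psi> (pair m c) (t (join y z)))
        \<and> (join y z 0 = 0 \<or> \<chi> (pair m c) (t (join y z))))" (is "_ \<longleftrightarrow> ?R") for c z
    proof
      assume "P c z \<or> Q c z"
      then show ?R
      proof
        assume "P c z"
        then obtain y where "\<forall>m. \<psi> (pair m c) (join y z)" using \<psi>(2) by blast
        then show ?R by (intro exI[of _ "case_nat 0 y"]) (simp add: t)
      next
        assume "Q c z"
        then obtain y where "\<forall>m. \<chi> (pair m c) (join y z)" using \<chi>(2) by blast
        then show ?R by (intro exI[of _ "case_nat 1 y"]) (simp add: t)
      qed
    next
      assume ?R
      then show "P c z \<or> Q c z" unfolding \<psi>(2) \<chi>(2) t join_0 by blast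
    qed
  qed
qed

lemma sigma_conj [sintros]:
  assumes "sigma P" "sigma Q" shows "sigma (\<lambda>c z. P c z \<and> Q c z)"
proof -
  obtain \<psi> where \<psi>: "decp single \<psi>" "\<And>c z. P c z \<longleftrightarrow> (\<exists>y. \<forall>m. \<psi> (pair m c) (join y z))"
    using assms(1) by (rule sigmaE) blast
  obtain \<chi> where \<chi>: "decp single \<chi>" "\<And>c z. Q c z \<longleftrightarrow> (\<exists>y. \<forall>m. \<chi> (pair m c) (join y z))"
    using assms(2) by (rule sigmaE) blast
  define s where "s z = (\<lambda>i. if even i then z (2 * (2 * (i div 2))) else z i)" for z :: "nat \<Rightarrow> nat"
  define t where "t z = (\<lambda>i. if even i then z (2 * Suc (2 * (i div 2))) else z i)" for z :: "nat \<Rightarrow> nat"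
  have s: "s (join y z) = join (\<lambda>i. y (2 * i)) z" for y z
    unfolding s_def join_even by (auto simp: join_def)
  have t: "t (join y z) = join (\<lambda>i. y (Suc (2 * i))) z" for y z
    unfolding t_def join_even by (auto simp: join_def)
  show ?thesis
  proof (rule sigmaI)
    have "decp single (\<lambda>c z. \<psi> c (s z))" "decp single (\<lambda>c z. \<chi> c (t z))" unfolding s_def t_def
      by (intro decp_single_subst[OF \<psi>(1)] decp_single_subst[OF \<chi>(1)] cintros)+
    then show "decp single (\<lambda>c z. \<psi> c (s z) \<and> \<chi> c (t z))"
      by (intro cintros)
    show "P c z \<and> Q c z \<longleftrightarrow> (\<exists>y. \<forall>m. \<psi> (pair m c) (s (join y z)) \<and> \<chi> (pair m c) (t (join y z)))"
      (is "_ \<longleftrightarrow> ?R") for c z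
    proof
      assume "P c z \<and> Q c z"
      then obtain y y' where "\<forall>m. \<psi> (pair m c) (join y z)" "\<forall>m. \<chi> (pair m c) (join y' z)"
        using \<psi>(2) \<chi>(2) by blast
      then show ?R by (intro exI[of _ "join y y'"]) (simp add: s t)
    qed (unfold \<psi>(2) \<chi>(2) s t, blast)
  qed
qed

text \<open>The premise is decidable because \<open>sigma\<close> is not closed under
  negation.\<close>

lemma sigma_imp [sintros]:
  assumes "decp single P" "sigma Q" shows "sigma (\<lambda>c z. P c z \<longrightarrow> Q c z)"
  using sigma_disj[OF sigma_dec[OF decp_not[OF assms(1)]] assms(2)] by simp

section \<open>The pointclasses of the theorem in terms of \<open>sigma\<close>\<close>

lemma prod_space_2_1: "prod_space 2 1 = {([n, k], [h]) | n k h. True}"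
  by (auto simp: prod_space_def length_Suc_conv numeral_2_eq_2)

lemma Sigma11_2_1_iff:
  "A \<in> Sigma11 2 1 \<longleftrightarrow> (\<exists>p. A = {([n, k], [h]) | n k h. \<exists>y. \<not> (\<exists>v. eval [y, h] p [n, k] v)})"
proof -
  have Pi: "C \<in> Pi01 2 (Suc 1) \<longleftrightarrow>
      (\<exists>p. C = prod_space 2 (Suc 1) - {(ns, xs) \<in> prod_space 2 (Suc 1). \<exists>v. eval xs p ns v})" for C
    unfolding Pi01_def Sigma01_def by blast
  have *: "{(ns, xs) \<in> prod_space 2 1. \<exists>y. (ns, y # xs) \<in> prod_space 2 (Suc 1)
        - {(ns, xs) \<in> prod_space 2 (Suc 1). \<exists>v. eval xs p ns v}}
      = {([n, k], [h]) | n k h. \<exists>y. \<not> (\<exists>v. eval [y, h] p [n, k] v)}" for p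
    unfolding prod_space_2_1 by (auto simp: prod_space_def)
  have "A \<in> Sigma11 2 1 \<longleftrightarrow> (\<exists>p. A = {(ns, xs) \<in> prod_space 2 1. \<exists>y. (ns, y # xs) \<in> prod_space 2 (Suc 1)
        - {(ns, xs) \<in> prod_space 2 (Suc 1). \<exists>v. eval xs p ns v}})"
    unfolding Sigma11_def mem_Collect_eq Pi by blast
  then show ?thesis unfolding * .
qed

text \<open>The \<open>\<Pi>\<^sup>0\<^sub>1\<close> matrix is the divergence of the search for a
  number that violates the decidable matrix.\<close>

lemma Sigma11I:
  assumes "sigma \<phi>" shows "{([n, k], [h]) | n k h. \<phi> (pair n k) h} \<in> Sigma11 2 1"
proof -
  obtain \<psi> where \<psi>: "decp single \<psi>" "\<And>c z. \<phi> c z \<longleftrightarrow> (\<exists>y. \<forall>m. \<psi> (pair m c) (join y z))"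
    using assms by (rule sigmaE) blast
  let ?D = "\<lambda>r :: (nat \<Rightarrow> nat) \<times> (nat \<Rightarrow> nat). [fst r, snd r]"
  have o: "cfun ?D t \<Longrightarrow> cfun ?D (\<lambda>c r. fst r (t c r))" "cfun ?D t \<Longrightarrow> cfun ?D (\<lambda>c r. snd r (t c r))" for t
    using cfun_oracle[of 0 ?D t] cfun_oracle[of 1 ?D t] by simp_all
  have "decp ?D (\<lambda>c r. \<psi> c (join (fst r) (snd r)))"
    unfolding join_def by (intro decp_single_subst[OF \<psi>(1)] cintros o)
  then obtain q where q: "\<And>c r. eval [fst r, snd r] q [c] (of_bool (\<psi> c (join (fst r) (snd r))))"
    unfolding decp_def by (rule cfunE) blast
  let ?q = "Comp q [Comp pair_prog [Proj 0, Comp pair_prog [Proj 1, Proj 2]]]"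
  have q': "eval [y, h] ?q [m, n, k] (of_bool (\<psi> (pair m (pair n k)) (join y h)))" for m n k y h
  proof (rule eval_Comp1)
    show "eval [y, h] (Comp pair_prog [Proj 0, Comp pair_prog [Proj 1, Proj 2]]) [m, n, k]
        (pair m (pair n k))"
      by (rule eval_Comp2[OF _ eval_Comp2[OF _ _ eval_pair_prog] eval_pair_prog])
        (simp_all add: eval_Proj_eq)
    show "eval [y, h] q [pair m (pair n k)] (of_bool (\<psi> (pair m (pair n k)) (join y h)))"
      using q[of "(y, h)"] by simp
  qed
  have "(\<exists>v. eval [y, h] (Mu ?q) [n, k] v) \<longleftrightarrow> (\<exists>m. \<not> \<psi> (pair m (pair n k)) (join y h))" for y h n k
  proof
    assume "\<exists>v. eval [y, h] (Mu ?q) [n, k] v"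
    then obtain m where "eval [y, h] ?q [m, n, k] 0" by (auto elim: eval_MuE)
    from eval_deterministic[OF this q'] show "\<exists>m. \<not> \<psi> (pair m (pair n k)) (join y h)" by auto
  next
    assume ex: "\<exists>m. \<not> \<psi> (pair m (pair n k)) (join y h)"
    define m where "m = (LEAST m. \<not> \<psi> (pair m (pair n k)) (join y h))"
    have m: "\<not> \<psi> (pair m (pair n k)) (join y h)" unfolding m_def using ex by (rule LeastI_ex)
    have less: "\<psi> (pair i (pair n k)) (join y h)" if "i < m" for i
      using not_less_Least[of i "\<lambda>m. \<not> \<psi> (pair m (pair n k)) (join y h)"] that by (auto simp: m_def)
    have "eval [y, h] (Mu ?q) [n, k] m"
    proof (rule eval_Mu)
      show "eval [y, h] ?q [m, n, k] 0" using q'[of y h m n k] m by simp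
      show "\<forall>i<m. \<exists>j. eval [y, h] ?q [i, n, k] (Suc j)"
        using q' less by (metis One_nat_def of_bool_eq(2))
    qed
    then show "\<exists>v. eval [y, h] (Mu ?q) [n, k] v" ..
  qed
  then have "{([n, k], [h]) | n k h. \<phi> (pair n k) h}
    = {([n, k], [h]) | n k h. \<exists>y. \<not> (\<exists>v. eval [y, h] (Mu ?q) [n, k] v)}"
    by (simp add: \<psi>(2))
  then show ?thesis unfolding Sigma11_2_1_iff by blast
qed

text \<open>Divergence means that bounded evaluation returns 0 for every bound, a universal number
  quantifier over a decidable matrix.\<close>

lemma Sigma11E:
  assumes "A \<in> Sigma11 2 1"
  obtains \<phi> where "sigma \<phi>" "A = {([n, k], [h]) | n k h. \<phi> (pair n k) h}"
proof -
  obtain p where A: "A = {([n, k], [h]) | n k h. \<exists>y. \<not> (\<exists>v. eval [y, h] p [n, k] v)}"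
    using assms unfolding Sigma11_2_1_iff by blast
  let ?X = "\<lambda>c z. [\<lambda>i. z (2 * i), \<lambda>i. z (Suc (2 * i))] :: (nat \<Rightarrow> nat) list"
  let ?a = "\<lambda>c. Suc (pair (pfst c) (Suc (pair (psnd c) 0)))"
  have X: "coracles single 2 ?X"
    unfolding coracles_def
    by (auto simp: less_2_cases_iff intro!: cfun_single cfun_times2 cfun_Suc cfun_pfst cfun_id)
  have "decp single (\<lambda>c z. ev (pfst c) (?X c z) p (list_decode (?a (psnd c))) = 0)"
    by (intro decp_eq cfun_ev[where L = 2] X cintros)
  moreover have "(\<exists>y. \<not> (\<exists>v. eval [y, h] p [pfst c, psnd c] v)) \<longleftrightarrow>
      (\<exists>y. \<forall>m. ev (pfst (pair m c)) (?X (pair m c) (join y h)) p (list_decode (?a (psnd (pair m c)))) = 0)" for c h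
    unfolding eval_iff_ev by (simp add: not0_implies_Suc) (metis nat.exhaust nat.distinct(1))
  ultimately have "sigma (\<lambda>c h. \<exists>y. \<not> (\<exists>v. eval [y, h] p [pfst c, psnd c] v))"
    by (rule sigmaI)
  then show ?thesis by (rule that) (simp add: A)
qed

text \<open>
  \<open>refutes b \<phi>\<close>: the \<open>\<Sigma>\<^sup>1\<^sub>1\<close> predicate \<open>\<phi> c z\<close> fails for the witness \<open>y\<close> iff the first \<open>N\<close> values
  of \<open>join y z\<close> show this to \<open>b\<close> for some \<open>N\<close>.
\<close>

definition refutes :: "(nat \<Rightarrow> (nat \<Rightarrow> nat) \<Rightarrow> bool) \<Rightarrow> (nat \<Rightarrow> (nat \<Rightarrow> nat) \<Rightarrow> bool) \<Rightarrow> bool" where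
  "refutes b \<phi> \<longleftrightarrow> decp single b
    \<and> (\<forall>N M c u v. N \<le> M \<longrightarrow> (\<forall>i<N. u i = v i) \<longrightarrow> b (pair N c) u \<longrightarrow> b (pair M c) v)
    \<and> (\<forall>c z. \<phi> c z \<longleftrightarrow> (\<exists>y. \<forall>N. \<not> b (pair N c) (join y z)))"

lemma refutesE:
  assumes "sigma \<phi>" obtains b where "refutes b \<phi>"
proof -
  obtain \<psi> where \<psi>: "decp single \<psi>" "\<And>c z. \<phi> c z \<longleftrightarrow> (\<exists>y. \<forall>m. \<psi> (pair m c) (join y z))"
    using assms by (rule sigmaE) blast
  obtain p where p: "\<And>c z. eval [z] p [c] (of_bool (\<psi> c z))"
    using \<psi>(1) unfolding decp_def by (rule cfunE) (auto simp: single_def)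
  \<comment> \<open>The one number \<open>pfst c\<close> bounds both the counterexample and its
    evaluation, so that refutations persist when it grows.\<close>
  define b where "b c u \<longleftrightarrow> (\<exists>m<pfst c. ev (pfst c) [u] p [pair m (psnd c)] = 1)" for c u
  have e: "list_decode (Suc (pair a 0)) = [a]" for a by simp
  have X: "coracles single 1 (\<lambda>c z. [z])"
    unfolding coracles_def by (auto intro!: cfun_single cfun_pfst cfun_id)
  have "decp single (\<lambda>c u. \<exists>m<pfst c. ev (pfst c) [u] p (list_decode (Suc (pair (pair m (psnd c)) 0))) = 1)"
    by (intro cintros cfun_ev[where L = 1] X)
  then have dec: "decp single b" unfolding e b_def .
  have mono: "b (pair M c) v"
    if le: "N \<le> M" and agree: "\<forall>i<N. u i = v i" and b: "b (pair N c) u" for N M c u v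
  proof -
    obtain m where m: "m < N" "ev N [u] p [pair m c] = Suc 0" using b by (auto simp: b_def)
    have "ev M [v] p [pair m c] = Suc 0"
      by (rule ev_mono[OF le _ _ m(2)]) (use agree in auto)
    then show ?thesis using m(1) le by (auto simp: b_def intro: less_le_trans)
  qed
  have b_iff: "(\<exists>N. b (pair N c) u) \<longleftrightarrow> (\<exists>m. \<not> \<psi> (pair m c) u)" for c u
  proof
    assume "\<exists>N. b (pair N c) u"
    then obtain N m where "ev N [u] p [pair m c] = Suc 0" by (auto simp: b_def)
    then have "eval [u] p [pair m c] 0" by (rule ev_sound)
    from eval_deterministic[OF this p] show "\<exists>m. \<not> \<psi> (pair m c) u" by auto
  next
    assume "\<exists>m. \<not> \<psi> (pair m c) u"
    then obtain m where "eval [u] p [pair m c] 0" using p[of u] by (metis of_bool_eq(1))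
    then obtain N where "ev N [u] p [pair m c] = Suc 0" using ev_complete by blast
    then have "ev (max N (Suc m)) [u] p [pair m c] = Suc 0" by (rule ev_mono_bound) simp
    then have "b (pair (max N (Suc m)) c) u" by (auto simp: b_def intro: exI[of _ m])
    then show "\<exists>N. b (pair N c) u" ..
  qed
  have "refutes b \<phi>" unfolding refutes_def
  proof (intro conjI allI impI)
    show "\<phi> c z \<longleftrightarrow> (\<exists>y. \<forall>N. \<not> b (pair N c) (join y z))" for c z
      unfolding \<psi>(2) using b_iff by blast
    show "b (pair M c) v" if "N \<le> M" "\<forall>i<N. u i = v i" "b (pair N c) u" for N M c u v
      using that by (rule mono)
  qed (rule dec)
  then show ?thesis by (rule that)
qed

section \<open>Trees, the Kleene--Brouwer order and boundedness\<close>

text \<open>Lists are compared from the root of the tree; nodes are stored newest entry first and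
  therefore pass through \<open>rev\<close>. Proper extensions lie below their initial segments,
  which puts the root on top.\<close>

fun kb :: "nat list \<Rightarrow> nat list \<Rightarrow> bool" where
  "kb [] t = False"
| "kb (x # s) [] = True"
| "kb (x # s) (y # t) = (x < y \<or> x = y \<and> kb s t)"

lemma kb_irrefl [simp]: "\<not> kb s s" by (induction s) auto

lemma kb_trans: "kb s t \<Longrightarrow> kb t r \<Longrightarrow> kb s r"
proof (induction s t arbitrary: r rule: kb.induct)
  case (2 x s)
  then show ?case by simp
next
  case (3 x s y t)
  then show ?case by (cases r) auto
qed simp

lemma kb_total: "kb s t \<or> s = t \<or> kb t s"
proof (induction s t rule: kb.induct)
  case (1 t)
  then show ?case by (cases t) auto
qed auto

lemma kb_append [simp]: "kb (p @ s) (p @ t) = kb s t" by (induction p) auto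

lemma kb_append_self [simp]: "kb (p @ [x]) p" by (induction p) auto

text \<open>All quantifiers are bounded, which is the form that yields decidability.\<close>

lemma kb_iff:
  "kb s t \<longleftrightarrow> (\<exists>i<length s. (\<forall>j<i. j < length t \<and> s ! j = t ! j) \<and> (length t \<le> i \<or> s ! i < t ! i))"
proof (induction s t rule: kb.induct)
  case (2 x s)
  show ?case by (auto intro!: exI[of _ 0])
next
  case (3 x s y t)
  show ?case (is "_ \<longleftrightarrow> ?R")
  proof
    assume "kb (x # s) (y # t)"
    then consider "x < y" | "x = y" "kb s t" by auto
    then show ?R
    proof cases
      case 1
      then show ?thesis by (intro exI[of _ 0]) simp
    next
      case 2
      then obtain i where "i < length s" "\<forall>j<i. j < length t \<and> s ! j = t ! j"
        "length t \<le> i \<or> s ! i < t ! i" using 3 by blast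
      then show ?thesis using 2(1) by (intro exI[of _ "Suc i"]) (auto simp: less_Suc_eq_0_disj)
    qed
  next
    assume ?R
    then obtain i where i: "i < length (x # s)"
      "\<forall>j<i. j < length (y # t) \<and> (x # s) ! j = (y # t) ! j"
      "length (y # t) \<le> i \<or> (x # s) ! i < (y # t) ! i" by blast
    show "kb (x # s) (y # t)"
    proof (cases i)
      case 0
      then show ?thesis using i by simp
    next
      case (Suc k)
      have "x = y" using i(2) Suc by force
      moreover have "\<forall>j<k. j < length t \<and> s ! j = t ! j"
      proof (intro allI impI)
        fix j assume "j < k"
        then show "j < length t \<and> s ! j = t ! j" using i(2)[rule_format, of "Suc j"] Suc by simp
      qed
      moreover have "k < length s" "length t \<le> k \<or> s ! k < t ! k" using i Suc by simp_all
      ultimately show ?thesis using 3 by auto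
    qed
  qed
qed simp

section \<open>Branches and wellfoundedness of the Kleene--Brouwer order\<close>

fun prefix_of :: "(nat \<Rightarrow> nat) \<Rightarrow> nat \<Rightarrow> nat list" where
  "prefix_of u 0 = []"
| "prefix_of u (Suc n) = u n # prefix_of u n"

lemma length_prefix_of [simp]: "length (prefix_of u n) = n" by (induction n) auto

lemma ext_Cons: "ext (n # s) i = (if i < length s then ext s i else if i = length s then n else 0)"
  by (auto simp: ext_def nth_append)

lemma ext_prefix_of: "i < n \<Longrightarrow> ext (prefix_of u n) i = u i"
  by (induction n) (auto simp: ext_Cons less_Suc_eq)

text \<open>If \<open>P\<close> failed at the root, every failure would have a failing child in
  \<open>J\<close>, and choosing such children forever would give a branch through
  \<open>J\<close>.\<close>

lemma bar_induct:
  assumes "J []" and no_branch: "\<nexists>u. \<forall>n. J (prefix_of u n)"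
    and step: "\<And>s. J s \<Longrightarrow> (\<And>n. J (n # s) \<Longrightarrow> P (n # s)) \<Longrightarrow> P s"
  shows "P []"
proof (rule ccontr)
  assume "\<not> P []"
  define next_node where "next_node s = (SOME n. J (n # s) \<and> \<not> P (n # s)) # s" for s
  define f where "f n = (next_node ^^ n) []" for n
  have f: "J (f n) \<and> \<not> P (f n)" for n
  proof (induction n)
    case 0
    then show ?case using \<open>\<not> P []\<close> \<open>J []\<close> by (simp add: f_def)
  next
    case (Suc n)
    then have "\<exists>m. J (m # f n) \<and> \<not> P (m # f n)" using step by blast
    then have "J (next_node (f n)) \<and> \<not> P (next_node (f n))"
      unfolding next_node_def by (rule someI_ex)
    then show ?case by (simp add: f_def)
  qed
  define u where "u n = hd (f (Suc n))" for n
  have "prefix_of u n = f n" for n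
    by (induction n) (simp_all add: u_def f_def next_node_def)
  then show False using f no_branch by metis
qed

lemma wf_kb:
  assumes closed: "\<And>n s. J (n # s) \<Longrightarrow> J s" and no_branch: "\<nexists>u. \<forall>n. J (prefix_of u n)"
  shows "wf {(s, t). J s \<and> J t \<and> kb (rev s) (rev t)}"
proof -
  \<comment> \<open>\<open>K s\<close> is the order on the nodes of \<open>J\<close> that extend
    \<open>s\<close>, with \<open>a @ s\<close> named by \<open>a\<close>; bar induction shows that
    all of it is accessible.\<close>
  define K where "K s = {(a, b). J (a @ s) \<and> J (b @ s) \<and> kb (rev a) (rev b)}" for s
  have closed': "J (r @ s) \<Longrightarrow> J s" for r s
    by (induction r) (auto dest: closed)
  have "\<forall>t. t \<in> Wellfounded.acc (K [])" if "J []"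
    using that no_branch
  proof (rule bar_induct)
    fix s assume "J s" and IH: "\<And>n. J (n # s) \<Longrightarrow> \<forall>t. t \<in> Wellfounded.acc (K (n # s))"
    \<comment> \<open>\<open>t @ [n]\<close> names a node at or beyond the child
      \<open>n # s\<close>. Whatever precedes it lies beyond a smaller child or in the same subtree,
      whose order is \<open>K (n # s)\<close>; hence an induction on \<open>n\<close> with an inner
      one along \<open>K (n # s)\<close>.\<close>
    have below: "t @ [n] \<in> Wellfounded.acc (K s)" for t n
    proof (induction n arbitrary: t rule: less_induct)
      case (less n)
      show ?case
      proof (cases "J (n # s)")
        case True
        then have "t \<in> Wellfounded.acc (K (n # s))" using IH by blast
        then show ?thesis
        proof (induction rule: Wellfounded.acc.induct)
          case (accI t)
          show ?case
          proof (rule Wellfounded.accI)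
            fix a assume a: "(a, t @ [n]) \<in> K s"
            then have "kb (rev a) (n # rev t)" by (simp add: K_def)
            then obtain m r where r: "rev a = m # r" and m: "m < n \<or> m = n \<and> kb r (rev t)"
              by (cases "rev a") auto
            from r have a_eq: "a = rev r @ [m]" by (simp add: rev_eq_Cons_iff)
            from m show "a \<in> Wellfounded.acc (K s)"
            proof
              assume "m < n"
              then show ?thesis unfolding a_eq by (rule less.IH)
            next
              assume "m = n \<and> kb r (rev t)"
              then have "(rev r, t) \<in> K (n # s)" using a unfolding a_eq K_def by simp
              then show ?thesis using accI.IH \<open>m = n \<and> kb r (rev t)\<close> unfolding a_eq by blast
            qed
          qed
        qed
      next
        case False
        have "(a, t @ [n]) \<notin> K s" for a
          using False closed'[of t "n # s"] by (auto simp: K_def)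
        then show ?thesis by (blast intro: Wellfounded.accI)
      qed
    qed
    have "[] \<in> Wellfounded.acc (K s)"
    proof (rule Wellfounded.accI)
      fix a assume "(a, []) \<in> K s"
      then have "a \<noteq> []" by (auto simp: K_def)
      then show "a \<in> Wellfounded.acc (K s)" using below[of "butlast a" "last a"] by simp
    qed
    then show "\<forall>t. t \<in> Wellfounded.acc (K s)" using below by (metis append_butlast_last_id)
  qed
  moreover have "K [] = {}" if "\<not> J []" using closed'[of _ "[]"] that by (auto simp: K_def)
  ultimately have "wf (K [])" by (cases "J []") (auto intro: acc_wfI)
  then show ?thesis by (simp add: K_def)
qed

definition strict :: "nat rel \<Rightarrow> nat \<Rightarrow> nat \<Rightarrow> bool" where
  "strict R a b \<longleftrightarrow> (a, b) \<in> R \<and> a \<noteq> b"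

definition kb_order :: "(nat list \<Rightarrow> bool) \<Rightarrow> nat rel" where
  "kb_order J = {(a, b). J (list_decode a) \<and> J (list_decode b)
    \<and> (a = b \<or> kb (rev (list_decode a)) (rev (list_decode b)))}"

lemma Well_order_kb_order:
  assumes closed: "\<And>n s. J (n # s) \<Longrightarrow> J s" and no_branch: "\<nexists>u. \<forall>n. J (prefix_of u n)"
  shows "Well_order (kb_order J)"
proof -
  have F: "Field (kb_order J) = {a. J (list_decode a)}" by (auto simp: kb_order_def Field_def)
  have "kb_order J - Id \<subseteq> inv_image {(s, t). J s \<and> J t \<and> kb (rev s) (rev t)} list_decode"
    by (auto simp: kb_order_def list_decode_eq)
  moreover have "wf {(s, t). J s \<and> J t \<and> kb (rev s) (rev t)}"
    using closed no_branch by (rule wf_kb)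
  ultimately have "wf (kb_order J - Id)" using wf_subset wf_inv_image by blast
  moreover have "refl_on (Field (kb_order J)) (kb_order J)"
    unfolding F by (auto simp: refl_on_def kb_order_def)
  moreover have "trans (kb_order J)" by (auto simp: trans_def kb_order_def dest: kb_trans)
  moreover have "antisym (kb_order J)"
    by (auto simp: antisym_def kb_order_def dest: kb_trans)
  moreover have "total_on (Field (kb_order J)) (kb_order J)"
  proof -
    have "(a, b) \<in> kb_order J \<or> (b, a) \<in> kb_order J" if "J (list_decode a)" "J (list_decode b)" for a b
      using kb_total[of "rev (list_decode a)" "rev (list_decode b)"] that
      by (auto simp: kb_order_def list_decode_eq)
    then show ?thesis unfolding F by (simp add: total_on_def)
  qed
  moreover have "kb_order J \<subseteq> Field (kb_order J) \<times> Field (kb_order J)" by (auto simp: Field_def)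
  ultimately show ?thesis
    by (simp add: well_order_on_def linear_order_on_def partial_order_on_def preorder_on_def)
qed

lemma decp_kb:
  assumes "cfun D F" "cfun D G"
  shows "decp D (\<lambda>c r. kb (rev (list_decode (F c r))) (rev (list_decode (G c r))))"
proof -
  have "kb (rev s) (rev t) \<longleftrightarrow> (\<exists>i<length s. (\<forall>j<i. j < length t \<and> ext s j = ext t j)
      \<and> (length t \<le> i \<or> ext s i < ext t i))" for s t
    unfolding kb_iff by (auto simp: ext_def)
  moreover have "decp D (\<lambda>c r. \<exists>i<length (list_decode (F c r)).
      (\<forall>j<i. j < length (list_decode (G c r)) \<and> ext (list_decode (F c r)) j = ext (list_decode (G c r)) j)
      \<and> (length (list_decode (G c r)) \<le> i \<or> ext (list_decode (F c r)) i < ext (list_decode (G c r)) i))"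
    by (intro cintros cfun_comp[OF assms(1)] cfun_comp[OF assms(2)])
  ultimately show ?thesis by simp
qed

lemma computable_relI:
  assumes "decp (\<lambda>_ :: unit. [f]) (\<lambda>c r. (pfst c, psnd c) \<in> R)" shows "computable_rel f R"
proof -
  obtain p where p: "\<And>c. eval [f] p [c] (of_bool ((pfst c, psnd c) \<in> R))"
    using assms unfolding decp_def by (rule cfunE) blast
  have "eval [f] (Comp p [pair_prog]) [m, n] (if (m, n) \<in> R then 1 else 0)" for m n
    using eval_Comp1[OF eval_pair_prog p, of m n] by (simp add: of_bool_def)
  then show ?thesis unfolding computable_rel_def by blast
qed

text \<open>The tree of attempts to find a witness for the predicate refuted by \<open>b\<close>.\<close>

definition tree :: "(nat \<Rightarrow> (nat \<Rightarrow> nat) \<Rightarrow> bool) \<Rightarrow> nat \<Rightarrow> (nat \<Rightarrow> nat) \<Rightarrow> nat list \<Rightarrow> bool" where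
  "tree b c z s \<longleftrightarrow> \<not> b (pair (length s) c) (join (ext s) z)"

section \<open>Monotonicity of refutations, and ranks of trees\<close>

lemma refutes_dec: "refutes b \<phi> \<Longrightarrow> decp single b"
  by (simp add: refutes_def)

lemma refutes_iff: "refutes b \<phi> \<Longrightarrow> \<phi> c z \<longleftrightarrow> (\<exists>y. \<forall>N. \<not> b (pair N c) (join y z))"
  by (simp add: refutes_def)

lemma refutes_mono:
  assumes "refutes b \<phi>" "b (pair N c) (join y z)" "N \<le> M"
    "\<And>i. i < N \<Longrightarrow> y i = y' i" "\<And>i. i < N \<Longrightarrow> z i = z' i"
  shows "b (pair M c) (join y' z')"
proof -
  have "\<forall>j<N. join y z j = join y' z' j" by (auto simp: join_def intro!: assms(4,5))
  then show ?thesis using assms(1-3) unfolding refutes_def by blast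
qed

text \<open>A comparison of ranks without ordinals: \<open>a\<close> bounds the rank of the subtree
  at \<open>s\<close>, where \<open>s\<close> itself need not belong to \<open>T\<close>. Being
  inductive, it excludes branches of \<open>T\<close> through \<open>s\<close> even if
  \<open>lt\<close> is illfounded.\<close>

inductive ranked :: "(nat \<Rightarrow> nat \<Rightarrow> bool) \<Rightarrow> (nat list \<Rightarrow> bool) \<Rightarrow> nat \<Rightarrow> nat list \<Rightarrow> bool"
  for lt :: "nat \<Rightarrow> nat \<Rightarrow> bool" and T :: "nat list \<Rightarrow> bool" where
  rankedI: "(\<And>n. T (n # s) \<Longrightarrow> \<exists>b. lt b a \<and> ranked lt T b (n # s)) \<Longrightarrow> ranked lt T a s"

lemma ranked_iff: "ranked lt T a s \<longleftrightarrow> (\<forall>n. T (n # s) \<longrightarrow> (\<exists>b. lt b a \<and> ranked lt T b (n # s)))"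
  by (subst ranked.simps) blast

lemma ranked_transfer:
  assumes "\<And>a b. lt b a \<Longrightarrow> lt' (h b) (h a)" "ranked lt T a s"
  shows "ranked lt' T (h a) s"
  using assms(2)
proof (induction rule: ranked.induct)
  case (rankedI s a)
  show ?case
  proof (rule ranked.rankedI)
    fix n assume "T (n # s)"
    then show "\<exists>b. lt' b (h a) \<and> ranked lt' T b (n # s)" using rankedI assms(1) by blast
  qed
qed

lemma ranked_no_branch:
  assumes "ranked lt T a s" "s = prefix_of u k" shows "\<exists>n. \<not> T (prefix_of u n)"
  using assms
proof (induction arbitrary: k rule: ranked.induct)
  case (rankedI s a)
  show ?case
  proof (cases "T (u k # s)")
    case True
    then show ?thesis using rankedI(1)[OF True] rankedI(2) by (metis prefix_of.simps(2))
  next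
    case False
    then show ?thesis using rankedI(2) by (intro exI[of _ "Suc k"]) simp
  qed
qed

text \<open>Induction runs along \<open>lt\<close> and not along the tree, so uniqueness also covers
  trees with infinite branches.\<close>

lemma ranked_unique:
  assumes wf: "wf {(b, a). lt b a}"
    and H: "\<And>a s. H a s \<longleftrightarrow> (\<forall>n. T (n # s) \<longrightarrow> (\<exists>b. lt b a \<and> H b (n # s)))"
  shows "H a s \<longleftrightarrow> ranked lt T a s"
  using wf
proof (induction a arbitrary: s rule: wf_induct_rule)
  case (less a)
  then show ?case by (subst H, subst ranked_iff) blast
qed

text \<open>All initial segments of a witness are nodes, because a refutation of a segment refutes
  the witness itself; but a ranked tree has no branch.\<close>

lemma ranked_tree:
  assumes "refutes b \<phi>" "ranked lt (tree b c z) a []" shows "\<not> \<phi> c z"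
proof
  assume "\<phi> c z"
  then obtain y where y: "\<not> b (pair N c) (join y z)" for N
    using refutes_iff[OF assms(1)] by blast
  have "tree b c z (prefix_of y n)" for n
  proof (rule ccontr)
    assume "\<not> tree b c z (prefix_of y n)"
    then have "b (pair n c) (join (ext (prefix_of y n)) z)" by (simp add: tree_def)
    then have "b (pair n c) (join y z)"
      by (rule refutes_mono[OF assms(1)]) (simp_all add: ext_prefix_of)
    with y show False by blast
  qed
  then show False using ranked_no_branch[OF assms(2), where u = y and k = 0] by simp
qed

text \<open>
  The classical proof of boundedness: a node of the tree \<open>joint\<close> attempts to find \<open>c\<close>, \<open>z\<close>, a witness \<open>w\<close>
  for \<open>B c (join z x)\<close> and a witness \<open>y\<close> for \<open>\<phi> c z\<close>. There is no branch, and for every \<open>c\<close> and \<open>z\<close>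
  with \<open>B c (join z x)\<close> the tree of \<open>\<phi> c z\<close> embeds into \<open>joint\<close>.
\<close>

definition joint ::
    "(nat \<Rightarrow> (nat \<Rightarrow> nat) \<Rightarrow> bool) \<Rightarrow> (nat \<Rightarrow> (nat \<Rightarrow> nat) \<Rightarrow> bool) \<Rightarrow> (nat \<Rightarrow> nat) \<Rightarrow> nat list \<Rightarrow> bool" where
  "joint d b x s \<longleftrightarrow> s = [] \<or>
    \<not> d (pair (length s - 1) (ext s 0))
        (join (\<lambda>i. pfst (ext s (Suc i))) (join (\<lambda>i. pfst (psnd (ext s (Suc i)))) x))
    \<and> \<not> b (pair (length s - 1) (ext s 0))
        (join (\<lambda>i. psnd (psnd (ext s (Suc i)))) (\<lambda>i. pfst (psnd (ext s (Suc i)))))"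

lemma refutes_mono2:
  assumes "refutes d B" "d (pair N c) (join w (join z x))" "N \<le> M"
    "\<And>i. i < N \<Longrightarrow> w i = w' i" "\<And>i. i < N \<Longrightarrow> z i = z' i"
  shows "d (pair M c) (join w' (join z' x))"
  by (rule refutes_mono[OF assms(1-4)]) (auto simp: join_def intro!: assms(5))

lemma joint_closed:
  assumes d: "refutes d B" and b: "refutes b \<phi>" and J: "joint d b x (n # s)"
  shows "joint d b x s"
proof (cases s)
  case (Cons m r)
  have e: "ext (n # s) i = ext s i" if "i < length s" for i using that by (simp add: ext_Cons)
  have 0: "ext (n # s) 0 = ext s 0" using e Cons by simp
  show ?thesis
  proof (rule ccontr)
    assume "\<not> joint d b x s"
    then consider
      "d (pair (length s - 1) (ext s 0))
        (join (\<lambda>i. pfst (ext s (Suc i))) (join (\<lambda>i. pfst (psnd (ext s (Suc i)))) x))"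
      | "b (pair (length s - 1) (ext s 0))
        (join (\<lambda>i. psnd (psnd (ext s (Suc i)))) (\<lambda>i. pfst (psnd (ext s (Suc i)))))"
      by (auto simp: joint_def)
    then show False
    proof cases
      case 1
      then have "d (pair (length (n # s) - 1) (ext s 0))
        (join (\<lambda>i. pfst (ext (n # s) (Suc i))) (join (\<lambda>i. pfst (psnd (ext (n # s) (Suc i)))) x))"
        by (rule refutes_mono2[OF d]) (simp_all add: e)
      then show ?thesis using J 0 by (simp add: joint_def)
    next
      case 2
      then have "b (pair (length (n # s) - 1) (ext s 0))
        (join (\<lambda>i. psnd (psnd (ext (n # s) (Suc i)))) (\<lambda>i. pfst (psnd (ext (n # s) (Suc i)))))"
        by (rule refutes_mono[OF b]) (simp_all add: e)
      then show ?thesis using J 0 by (simp add: joint_def)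
    qed
  qed
qed (simp add: joint_def)

text \<open>A branch would code a number, a real and witnesses for both \<open>B\<close> and
  \<open>\<phi>\<close> at them, against disjointness.\<close>

lemma joint_no_branch:
  assumes d: "refutes d B" and b: "refutes b \<phi>"
    and disj: "\<And>c z. B c (join z x) \<Longrightarrow> \<not> \<phi> c z"
  shows "\<nexists>u. \<forall>n. joint d b x (prefix_of u n)"
proof
  assume "\<exists>u. \<forall>n. joint d b x (prefix_of u n)"
  then obtain u where u: "\<And>n. joint d b x (prefix_of u n)" by blast
  have e: "ext (prefix_of u (Suc N)) i = u i" if "i \<le> N" for i N
    using that by (intro ext_prefix_of) simp
  let ?z = "\<lambda>i. pfst (psnd (u (Suc i)))"
  have "\<not> d (pair N (u 0)) (join (\<lambda>i. pfst (u (Suc i))) (join ?z x))" for N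
  proof
    let ?s = "prefix_of u (Suc N)"
    assume "d (pair N (u 0)) (join (\<lambda>i. pfst (u (Suc i))) (join ?z x))"
    then have "d (pair N (u 0)) (join (\<lambda>i. pfst (ext ?s (Suc i))) (join (\<lambda>i. pfst (psnd (ext ?s (Suc i)))) x))"
      by (rule refutes_mono2[OF d]) (simp_all add: e del: prefix_of.simps)
    then show False using u[of "Suc N"] e[of 0 N] by (simp add: joint_def del: prefix_of.simps) simp
  qed
  then have "B (u 0) (join ?z x)" using refutes_iff[OF d] by blast
  moreover have "\<not> b (pair N (u 0)) (join (\<lambda>i. psnd (psnd (u (Suc i)))) ?z)" for N
  proof
    let ?s = "prefix_of u (Suc N)"
    assume "b (pair N (u 0)) (join (\<lambda>i. psnd (psnd (u (Suc i)))) ?z)"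
    then have "b (pair N (u 0)) (join (\<lambda>i. psnd (psnd (ext ?s (Suc i)))) (\<lambda>i. pfst (psnd (ext ?s (Suc i)))))"
      by (rule refutes_mono[OF b]) (simp_all add: e del: prefix_of.simps)
    then show False using u[of "Suc N"] e[of 0 N] by (simp add: joint_def del: prefix_of.simps) simp
  qed
  then have "\<phi> (u 0) ?z" using refutes_iff[OF b] by blast
  ultimately show False using disj by blast
qed

lemma computable_joint:
  assumes d: "refutes d B" and b: "refutes b \<phi>"
  shows "computable_rel x (kb_order (joint d b x))"
proof (rule computable_relI)
  let ?D = "\<lambda>_ :: unit. [x]"
  have x: "cfun ?D t \<Longrightarrow> cfun ?D (\<lambda>c r. x (t c r))" for t
    using cfun_oracle[of 0 ?D t] by simp
  have z: "list_decode a = [] \<longleftrightarrow> a = 0" for a by (subst list_decode_case) simp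
  have J: "decp ?D (\<lambda>c r. joint d b x (list_decode c))"
    unfolding joint_def join_def z
    by (intro cintros decp_single_subst[OF refutes_dec[OF d]] decp_single_subst[OF refutes_dec[OF b]] x)
  show "decp ?D (\<lambda>c r. (pfst c, psnd c) \<in> kb_order (joint d b x))"
    unfolding kb_order_def mem_Collect_eq prod.case
    by (intro cintros decp_kb decp_comp[OF J])
qed

lemma boundedness:
  assumes b: "refutes b \<phi>" and B: "sigma B" and disj: "\<And>c z. B c (join z x) \<Longrightarrow> \<not> \<phi> c z"
  obtains L where "computable_wellorder x L"
    "\<And>c z. B c (join z x) \<Longrightarrow> \<exists>a. ranked (strict L) (tree b c z) a []"
proof -
  obtain d where d: "refutes d B" using B by (rule refutesE)
  let ?J = "joint d b x" and ?L = "kb_order (joint d b x)"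
  have wo: "Well_order ?L"
    by (intro Well_order_kb_order joint_no_branch[OF d b disj]) (rule joint_closed[OF d b])
  have wf: "wf {(s, t). ?J s \<and> ?J t \<and> kb (rev s) (rev t)}"
    by (intro wf_kb joint_no_branch[OF d b disj]) (rule joint_closed[OF d b])
  have "\<exists>a. ranked (strict ?L) (tree b c z) a []" if Bc: "B c (join z x)" for c z
  proof -
    let ?T = "tree b c z"
    obtain w where w: "\<And>N. \<not> d (pair N c) (join w (join z x))"
      using Bc refutes_iff[OF d] by blast
    \<comment> \<open>The embedding inserts the fixed \<open>c\<close>, \<open>w\<close> and
      \<open>z\<close>, so that only the attempt at a witness for \<open>\<phi>\<close> varies;
      \<open>c\<close> takes the first place, whence the length grows by one.\<close>
    define \<sigma> where "\<sigma> = rec_list [c] (\<lambda>n s r. pair (w (length s)) (pair (z (length s)) n) # r)"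
    have \<sigma>: "\<sigma> [] = [c]" "\<sigma> (n # s) = pair (w (length s)) (pair (z (length s)) n) # \<sigma> s" for n s
      by (simp_all add: \<sigma>_def)
    have len: "length (\<sigma> s) = Suc (length s)" for s by (induction s) (simp_all add: \<sigma>)
    have e0: "ext (\<sigma> s) 0 = c" for s by (induction s) (simp_all add: \<sigma> ext_Cons len)
    have e: "ext (\<sigma> s) (Suc i) = pair (w i) (pair (z i) (ext s i))" if "i < length s" for s i
      using that by (induction s) (auto simp: \<sigma> ext_Cons len less_Suc_eq)
    have J: "?J (\<sigma> s)" if "?T s" for s
    proof -
      have "\<not> d (pair (length s) c)
          (join (\<lambda>i. pfst (ext (\<sigma> s) (Suc i))) (join (\<lambda>i. pfst (psnd (ext (\<sigma> s) (Suc i)))) x))"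
      proof
        assume "d (pair (length s) c)
          (join (\<lambda>i. pfst (ext (\<sigma> s) (Suc i))) (join (\<lambda>i. pfst (psnd (ext (\<sigma> s) (Suc i)))) x))"
        then have "d (pair (length s) c) (join w (join z x))"
          by (rule refutes_mono2[OF d]) (simp_all add: e)
        with w show False by blast
      qed
      moreover have "\<not> b (pair (length s) c)
          (join (\<lambda>i. psnd (psnd (ext (\<sigma> s) (Suc i)))) (\<lambda>i. pfst (psnd (ext (\<sigma> s) (Suc i)))))"
      proof
        assume "b (pair (length s) c)
          (join (\<lambda>i. psnd (psnd (ext (\<sigma> s) (Suc i)))) (\<lambda>i. pfst (psnd (ext (\<sigma> s) (Suc i)))))"
        then have "b (pair (length s) c) (join (ext s) z)"
          by (rule refutes_mono[OF b]) (simp_all add: e)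
        with that show False by (simp add: tree_def)
      qed
      ultimately show ?thesis by (simp add: joint_def len e0)
    qed
    have T_closed: "?T s" if "?T (n # s)" for n s
    proof (rule ccontr)
      assume "\<not> ?T s"
      then have "b (pair (length s) c) (join (ext s) z)" by (simp add: tree_def)
      then have "b (pair (length (n # s)) c) (join (ext (n # s)) z)"
        by (rule refutes_mono[OF b]) (simp_all add: ext_Cons)
      with that show False by (simp add: tree_def)
    qed
    \<comment> \<open>The label of \<open>s\<close> is the code of its image, and the image of a
      child is lower in the Kleene--Brouwer order. That order depends on neither \<open>c\<close>
      nor \<open>z\<close>, so the bound is uniform.\<close>
    have "?T s \<Longrightarrow> ranked (strict ?L) ?T (list_encode t) s" if "t = \<sigma> s" for t s
      using wf that
    proof (induction t arbitrary: s rule: wf_induct_rule)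
      case (less t)
      show ?case
      proof (rule rankedI)
        fix n assume n: "?T (n # s)"
        have kb: "kb (rev (\<sigma> (n # s))) (rev (\<sigma> s))" by (simp add: \<sigma>)
        have "(\<sigma> (n # s), t) \<in> {(s, t). ?J s \<and> ?J t \<and> kb (rev s) (rev t)}"
          using kb J[OF n] J[OF less.prems(1)] less.prems(2) by simp
        then have "ranked (strict ?L) ?T (list_encode (\<sigma> (n # s))) (n # s)"
          using less.IH n by blast
        moreover have "strict ?L (list_encode (\<sigma> (n # s))) (list_encode t)"
          using kb J[OF n] J[OF less.prems(1)] less.prems(2)
          by (auto simp: strict_def kb_order_def list_encode_eq)
        ultimately show "\<exists>a. strict ?L a (list_encode t) \<and> ranked (strict ?L) ?T a (n # s)" by blast
      qed
    qed
    \<comment> \<open>A root outside the tree has no children in it, so any label does.\<close>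
    moreover have "ranked (strict ?L) ?T 0 []" if "\<not> ?T []"
      by (rule rankedI) (use that T_closed in blast)
    ultimately show ?thesis by blast
  qed
  then show ?thesis
    by (intro that[of ?L]) (simp_all add: computable_wellorder_def wo computable_joint[OF d b])
qed

section \<open>A universal \<open>\<Pi>\<^sup>1\<^sub>1\<close> set\<close>

primrec code :: "recf \<Rightarrow> nat" where
  "code Zero = pair 0 0"
| "code Succ = pair 1 0"
| "code (Proj i) = pair 2 i"
| "code (Oracle i) = pair 3 i"
| "code (Comp p qs) = pair 4 (pair (code p) (list_encode (map code qs)))"
| "code (Prec p q) = pair 5 (pair (code p) (code q))"
| "code (Mu p) = pair 6 (code p)"

text \<open>Makes the programs countable, for the cardinality argument about computable
  wellorders.\<close>

lemma code_inject: "code p = code q \<Longrightarrow> p = q"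
proof (induction p arbitrary: q)
  case (Comp p qs)
  then obtain p' qs' where q: "q = Comp p' qs'" by (cases q) auto
  have "p = p'" using Comp q by auto
  moreover have "map code qs = map code qs'" using Comp.prems q by (simp add: list_encode_eq)
  then have "qs = qs'" using Comp.IH(2) by (metis list.inj_map_strong)
  ultimately show ?case using q by simp
next
  case (Prec p1 p2)
  then show ?case by (cases q) auto
next
  case (Mu p)
  then show ?case by (cases q) auto
qed (case_tac q; simp)+

lemma code_eq_iff:
  "pair 0 0 = code p \<longleftrightarrow> p = Zero"
  "pair (Suc 0) 0 = code p \<longleftrightarrow> p = Succ"
  "pair 2 i = code p \<longleftrightarrow> p = Proj i"
  "pair 3 i = code p \<longleftrightarrow> p = Oracle i"
  "pair 4 (pair a b) = code p \<longleftrightarrow> (\<exists>q qs. a = code q \<and> b = list_encode (map code qs) \<and> p = Comp q qs)"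
  "pair 5 (pair a b) = code p \<longleftrightarrow> (\<exists>q q'. a = code q \<and> b = code q' \<and> p = Prec q q')"
  "pair 6 a = code p \<longleftrightarrow> (\<exists>q. a = code q \<and> p = Mu q)"
  by (cases p; auto)+

text \<open>
  \<open>closed W y h\<close>: the set \<open>{j. W j \<noteq> 0}\<close> of coded judgements is closed under the rules of \<^const>\<open>eval\<close>
  with oracles \<open>[y, h]\<close>. The judgements are \<open>eval_judg p a v\<close> for evaluation, \<open>evals_judg qs a us\<close> for simultaneous
  evaluation of a list of programs, and \<open>pos_judg p n a\<close> for positive values of \<open>p\<close> below \<open>n\<close>.
\<close>

abbreviation (input) eval_judg :: "nat \<Rightarrow> nat \<Rightarrow> nat \<Rightarrow> nat" where
  "eval_judg p a v \<equiv> pair 0 (pair p (pair a v))"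

abbreviation (input) evals_judg :: "nat \<Rightarrow> nat \<Rightarrow> nat \<Rightarrow> nat" where
  "evals_judg qs a us \<equiv> pair 1 (pair qs (pair a us))"

abbreviation (input) pos_judg :: "nat \<Rightarrow> nat \<Rightarrow> nat \<Rightarrow> nat" where
  "pos_judg p n a \<equiv> pair 2 (pair p (pair n a))"

abbreviation (input) cons_code :: "nat \<Rightarrow> nat \<Rightarrow> nat" where
  "cons_code n a \<equiv> Suc (pair n a)"

definition closed :: "(nat \<Rightarrow> nat) \<Rightarrow> (nat \<Rightarrow> nat) \<Rightarrow> (nat \<Rightarrow> nat) \<Rightarrow> bool" where
  "closed W y h \<longleftrightarrow>
    (\<forall>a. W (eval_judg (pair 0 0) a 0) \<noteq> 0)
  \<and> (\<forall>n. W (eval_judg (pair 1 0) (cons_code n 0) (Suc n)) \<noteq> 0)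
  \<and> (\<forall>n a. W (eval_judg (pair 2 0) (cons_code n a) n) \<noteq> 0)
  \<and> (\<forall>i n a v. W (eval_judg (pair 2 i) a v) \<noteq> 0 \<longrightarrow> W (eval_judg (pair 2 (Suc i)) (cons_code n a) v) \<noteq> 0)
  \<and> (\<forall>n. W (eval_judg (pair 3 0) (cons_code n 0) (y n)) \<noteq> 0)
  \<and> (\<forall>n. W (eval_judg (pair 3 1) (cons_code n 0) (h n)) \<noteq> 0)
  \<and> (\<forall>a. W (evals_judg 0 a 0) \<noteq> 0)
  \<and> (\<forall>q qs a u us. W (eval_judg q a u) \<noteq> 0 \<and> W (evals_judg qs a us) \<noteq> 0 \<longrightarrow> W (evals_judg (cons_code q qs) a (cons_code u us)) \<noteq> 0)
  \<and> (\<forall>p qs a us v. W (evals_judg qs a us) \<noteq> 0 \<and> W (eval_judg p us v) \<noteq> 0 \<longrightarrow> W (eval_judg (pair 4 (pair p qs)) a v) \<noteq> 0)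
  \<and> (\<forall>p q a v. W (eval_judg p a v) \<noteq> 0 \<longrightarrow> W (eval_judg (pair 5 (pair p q)) (cons_code 0 a) v) \<noteq> 0)
  \<and> (\<forall>p q n a u v. W (eval_judg (pair 5 (pair p q)) (cons_code n a) u) \<noteq> 0 \<and> W (eval_judg q (cons_code n (cons_code u a)) v) \<noteq> 0
      \<longrightarrow> W (eval_judg (pair 5 (pair p q)) (cons_code (Suc n) a) v) \<noteq> 0)
  \<and> (\<forall>p a. W (pos_judg p 0 a) \<noteq> 0)
  \<and> (\<forall>p n a k. W (pos_judg p n a) \<noteq> 0 \<and> W (eval_judg p (cons_code n a) (Suc k)) \<noteq> 0 \<longrightarrow> W (pos_judg p (Suc n) a) \<noteq> 0)
  \<and> (\<forall>p n a. W (pos_judg p n a) \<noteq> 0 \<and> W (eval_judg p (cons_code n a) 0) \<noteq> 0 \<longrightarrow> W (eval_judg (pair 6 p) a n) \<noteq> 0)"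

lemma closed_eval:
  assumes W: "closed W y h"
  shows "eval [y, h] p ns v \<Longrightarrow> W (eval_judg (code p) (list_encode ns) v) \<noteq> 0"
proof (induction rule: eval.induct)
  case (eval_Zero ns)
  show ?case using W by (simp add: closed_def)
next
  case (eval_Succ n)
  show ?case using W by (simp add: closed_def)
next
  case (eval_Proj i ns)
  then show ?case
  \<comment> \<open>The clauses of \<open>closed\<close> for projections shift the index by one
    entry at a time.\<close>
  proof (induction i arbitrary: ns)
    case 0
    then show ?case using W unfolding closed_def by (cases ns) simp_all
  next
    case (Suc i)
    then obtain n ms where ns: "ns = n # ms" "i < length ms" by (cases ns) auto
    have "W (eval_judg (pair 2 i) (list_encode ms) (ms ! i)) \<noteq> 0" using Suc.IH[OF ns(2)] by simp
    moreover have "\<forall>i n a v. W (eval_judg (pair 2 i) a v) \<noteq> 0 \<longrightarrow> W (eval_judg (pair 2 (Suc i)) (cons_code n a) v) \<noteq> 0"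
      using W unfolding closed_def by (elim conjE)
    ultimately show ?case unfolding ns by simp
  qed
next
  case (eval_Oracle i n)
  then have "i = 0 \<or> i = 1" by auto
  moreover have "W (eval_judg (pair 3 0) (cons_code n 0) (y n)) \<noteq> 0" "W (eval_judg (pair 3 1) (cons_code n 0) (h n)) \<noteq> 0"
    using W unfolding closed_def by - ((elim conjE, blast)+)
  ultimately show ?case by auto
next
  case (eval_Comp ns qs us p v)
  have "W (evals_judg (list_encode (map code qs)) (list_encode ns) (list_encode us)) \<noteq> 0"
    using eval_Comp.IH(1)
  proof (induction rule: list_all2_induct)
    case Nil
    show ?case using W unfolding closed_def by simp
  next
    case (Cons q qs u us)
    have "\<forall>q qs a u us. W (eval_judg q a u) \<noteq> 0 \<and> W (evals_judg qs a us) \<noteq> 0 \<longrightarrow> W (evals_judg (cons_code q qs) a (cons_code u us)) \<noteq> 0"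
      using W unfolding closed_def by (elim conjE)
    then show ?case using Cons by simp
  qed
  moreover have "\<forall>p qs a us v. W (evals_judg qs a us) \<noteq> 0 \<and> W (eval_judg p us v) \<noteq> 0
      \<longrightarrow> W (eval_judg (pair 4 (pair p qs)) a v) \<noteq> 0"
    using W unfolding closed_def by (elim conjE)
  ultimately show ?case using eval_Comp.IH(2) unfolding code.simps by blast
next
  case (eval_Prec_0 p ns v q)
  moreover have "\<forall>p q a v. W (eval_judg p a v) \<noteq> 0 \<longrightarrow> W (eval_judg (pair 5 (pair p q)) (cons_code 0 a) v) \<noteq> 0"
    using W unfolding closed_def by (elim conjE)
  ultimately show ?case by simp
next
  case (eval_Prec_Suc p q n ns u v)
  moreover have "\<forall>p q n a u v. W (eval_judg (pair 5 (pair p q)) (cons_code n a) u) \<noteq> 0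
      \<and> W (eval_judg q (cons_code n (cons_code u a)) v) \<noteq> 0 \<longrightarrow> W (eval_judg (pair 5 (pair p q)) (cons_code (Suc n) a) v) \<noteq> 0"
    using W unfolding closed_def by (elim conjE)
  ultimately show ?case unfolding code.simps list_encode.simps by blast
next
  case (eval_Mu p n ns)
  have M: "\<forall>p a. W (pos_judg p 0 a) \<noteq> 0"
    "\<forall>p n a k. W (pos_judg p n a) \<noteq> 0 \<and> W (eval_judg p (cons_code n a) (Suc k)) \<noteq> 0 \<longrightarrow> W (pos_judg p (Suc n) a) \<noteq> 0"
    "\<forall>p n a. W (pos_judg p n a) \<noteq> 0 \<and> W (eval_judg p (cons_code n a) 0) \<noteq> 0 \<longrightarrow> W (eval_judg (pair 6 p) a n) \<noteq> 0"
    using W unfolding closed_def by - ((elim conjE, blast)+)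
  have "m \<le> n \<Longrightarrow> W (pos_judg (code p) m (list_encode ns)) \<noteq> 0" for m
  proof (induction m)
    case 0
    show ?case using M(1) by blast
  next
    case (Suc m)
    then obtain k where "W (eval_judg (code p) (list_encode (m # ns)) (Suc k)) \<noteq> 0"
      using eval_Mu.IH(2) by (meson Suc_le_eq)
    then show ?case using M(2) Suc unfolding list_encode.simps by (meson Suc_leD)
  qed
  from this[of n] show ?case
    using M(3) eval_Mu.IH(1) unfolding code.simps list_encode.simps by blast
qed

text \<open>A number that is no code counts as a program with all outputs, so that no clause of \<^const>\<open>closed\<close>
  can fail on account of such numbers.\<close>

definition eval_judgements :: "(nat \<Rightarrow> nat) list \<Rightarrow> nat \<Rightarrow> nat" where
  "eval_judgements xs j = (let x = pfst (psnd j); y = pfst (psnd (psnd j)); z = psnd (psnd (psnd j)) in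
    of_bool (if pfst j = 0 then \<forall>p. x = code p \<longrightarrow> eval xs p (list_decode y) z
      else if pfst j = 1 then \<forall>qs. x = list_encode (map code qs) \<longrightarrow>
        list_all2 (\<lambda>q u. eval xs q (list_decode y) u) qs (list_decode z)
      else \<forall>p. x = code p \<longrightarrow> (\<forall>m<y. \<exists>k. eval xs p (m # list_decode z) (Suc k))))"

lemma eval_judgements_simps:
  "eval_judgements xs (pair 0 (pair p (pair a v))) \<noteq> 0 \<longleftrightarrow> (\<forall>p'. p = code p' \<longrightarrow> eval xs p' (list_decode a) v)"
  "eval_judgements xs (pair 1 (pair qs (pair a us))) \<noteq> 0 \<longleftrightarrow> (\<forall>qs'. qs = list_encode (map code qs') \<longrightarrow>
     list_all2 (\<lambda>q u. eval xs q (list_decode a) u) qs' (list_decode us))"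
  "eval_judgements xs (pair 2 (pair p (pair n a))) \<noteq> 0 \<longleftrightarrow> (\<forall>p'. p = code p' \<longrightarrow>
     (\<forall>m<n. \<exists>k. eval xs p' (m # list_decode a) (Suc k)))"
  by (simp_all add: eval_judgements_def Let_def)

lemma closed_eval_judgements: "closed (eval_judgements [y, h]) y h"
proof -
  have L: "list_encode (map code qs) = cons_code q rs \<longleftrightarrow>
      (\<exists>q' qs'. qs = q' # qs' \<and> q = code q' \<and> rs = list_encode (map code qs'))" for qs q rs
    by (cases qs) auto
  have Nil: "0 = list_encode (map code qs) \<longleftrightarrow> qs = []" for qs
    by (cases qs) auto
  have O: "eval [y, h] (Oracle 0) [n] (y n)" "eval [y, h] (Oracle (Suc 0)) [n] (h n)" for n
    using eval_Oracle[of 0 "[y, h]" n] eval_Oracle[of 1 "[y, h]" n] by simp_all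
  have P: "eval xs (Proj (Suc i)) (n # ns) v" if "eval xs (Proj i) ns v" for xs i n ns v
    using that by (auto elim!: eval_ProjE intro!: eval_Proj_eq)
  show ?thesis
    unfolding closed_def eval_judgements_simps
    apply (intro conjI)
                 apply (auto simp: code_eq_iff Nil intro: eval_Zero)[1]
                apply (auto simp: code_eq_iff intro: eval_Succ)[1]
               apply (auto simp: code_eq_iff intro: eval_Proj_eq)[1]
              apply (auto simp: code_eq_iff intro: P)[1]
             apply (auto simp: code_eq_iff O)[1]
            apply (auto simp: code_eq_iff O)[1]
           apply (auto simp: Nil)[1]
          apply (auto simp: L eq_commute[of "Suc _"])[1]
         apply (auto simp: code_eq_iff intro: eval_Comp)[1]
        apply (auto simp: code_eq_iff intro: eval_Prec_0)[1]
       apply (auto simp: code_eq_iff intro: eval_Prec_Suc)[1]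
      apply (auto simp: code_eq_iff)[1]
     apply (auto simp: code_eq_iff less_Suc_eq)[1]
    apply (auto simp: code_eq_iff intro: eval_Mu)[1]
    done
qed

text \<open>
  The complement of a diagonal of a universal \<open>\<Pi>\<^sup>1\<^sub>1\<close> set: \<^const>\<open>eval\<close> is the least relation closed under
  its rules, so that divergence is \<open>\<Sigma>\<^sup>1\<^sub>1\<close> uniformly in the program.
\<close>

definition diverges :: "nat \<Rightarrow> (nat \<Rightarrow> nat) \<Rightarrow> bool" where
  "diverges c h \<longleftrightarrow> (\<exists>y W. closed W y h \<and> (\<forall>v. W (eval_judg (pfst c) (cons_code (pfst c) (cons_code (psnd c) 0)) v) = 0))"

lemma sigma_diverges: "sigma diverges"
  unfolding diverges_def closed_def by (intro sintros) (intro sigma_dec cintros)+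

text \<open>Every closed set contains all halting computations, and \<open>eval_judgements\<close>
  is a closed set that contains no other judgement about a genuine program.\<close>

lemma diverges_code:
  "diverges (pair (code p) k) h \<longleftrightarrow> (\<exists>y. \<not> (\<exists>v. eval [y, h] p [code p, k] v))"
proof -
  have ns: "cons_code (code p) (cons_code k 0) = list_encode [code p, k]" by simp
  have "(\<exists>W. closed W y h \<and> (\<forall>v. W (eval_judg (code p) (list_encode [code p, k]) v) = 0))
    \<longleftrightarrow> \<not> (\<exists>v. eval [y, h] p [code p, k] v)" for y
  proof
    assume "\<exists>W. closed W y h \<and> (\<forall>v. W (eval_judg (code p) (list_encode [code p, k]) v) = 0)"
    then show "\<not> (\<exists>v. eval [y, h] p [code p, k] v)" using closed_eval by blast
  next
    assume "\<not> (\<exists>v. eval [y, h] p [code p, k] v)"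
    then have "eval_judgements [y, h] (eval_judg (code p) (list_encode [code p, k]) v) = 0" for v
      using eval_judgements_simps(1)[of "[y, h]" "code p" "list_encode [code p, k]" v] by auto
    then show "\<exists>W. closed W y h \<and> (\<forall>v. W (eval_judg (code p) (list_encode [code p, k]) v) = 0)"
      using closed_eval_judgements by blast
  qed
  then show ?thesis unfolding diverges_def pfst_pair psnd_pair ns by blast
qed

section \<open>Selection by rank, and \<open>\<omega>\<^sub>1\<close>\<close>

text \<open>The value 0 marks that nothing is ranked and keeps the selection total. The shift of a
  selected \<open>k\<close> to \<open>Suc k\<close> is also what makes the diagonal function differ
  from \<open>F f\<close>.\<close>

definition sel :: "(nat \<Rightarrow> nat \<Rightarrow> bool) \<Rightarrow> (nat \<Rightarrow> (nat \<Rightarrow> nat) \<Rightarrow> bool) \<Rightarrow> (nat \<Rightarrow> nat) \<Rightarrow> nat \<Rightarrow> nat" where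
  "sel lt b h n = (if \<exists>k a. ranked lt (tree b (pair n k) h) a []
    then Suc (LEAST k. \<exists>a. ranked lt (tree b (pair n k) h) a []) else 0)"

lemma sel_eq_iff:
  "sel lt b h n = j \<longleftrightarrow>
    (\<exists>k. j = Suc k \<and> (\<exists>a. ranked lt (tree b (pair n k) h) a [])
       \<and> (\<forall>i. i < k \<longrightarrow> (\<forall>a. \<not> ranked lt (tree b (pair n i) h) a [])))
    \<or> j = 0 \<and> (\<forall>k a. \<not> ranked lt (tree b (pair n k) h) a [])"
proof -
  define R where "R k \<longleftrightarrow> (\<exists>a. ranked lt (tree b (pair n k) h) a [])" for k
  have "(if \<exists>k. R k then Suc (LEAST k. R k) else 0) = j \<longleftrightarrow>
      (\<exists>k. j = Suc k \<and> R k \<and> (\<forall>i. i < k \<longrightarrow> \<not> R i)) \<or> j = 0 \<and> (\<forall>k. \<not> R k)" (is "?l = j \<longleftrightarrow> ?r")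
  proof
    assume l: "?l = j"
    show ?r
    proof (cases "\<exists>k. R k")
      case True
      then have "R (LEAST k. R k)" by (rule LeastI_ex)
      then show ?thesis using l True by (auto dest: not_less_Least)
    next
      case False
      then show ?thesis using l by simp
    qed
  next
    assume ?r
    then show "?l = j"
    proof
      assume "\<exists>k. j = Suc k \<and> R k \<and> (\<forall>i. i < k \<longrightarrow> \<not> R i)"
      then obtain k where k: "j = Suc k" "R k" "\<And>i. i < k \<Longrightarrow> \<not> R i" by blast
      have "(LEAST k. R k) = k" using k(2,3) by (intro Least_equality) (auto intro: leI)
      then show ?thesis using k by auto
    qed simp
  qed
  then show ?thesis unfolding sel_def R_def by simp
qed

text \<open>
  \<open>rank_table e b H h\<close>: at the code of \<open>a\<close>, \<open>c\<close> and \<open>s\<close>, the real \<open>H\<close> stores the value of \<^const>\<open>ranked\<close>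
  for the order enumerated by \<open>e\<close> and the tree of \<open>b\<close> at \<open>c\<close> and \<open>h\<close>. For a wellfounded order this
  determines \<open>H\<close> up to its nonzero values, which makes the selection \<open>\<Delta>\<^sup>1\<^sub>1\<close>.
\<close>

definition rank_table ::
    "(nat \<Rightarrow> (nat \<Rightarrow> nat) \<Rightarrow> bool) \<Rightarrow> (nat \<Rightarrow> (nat \<Rightarrow> nat) \<Rightarrow> bool) \<Rightarrow> (nat \<Rightarrow> nat) \<Rightarrow> (nat \<Rightarrow> nat) \<Rightarrow> bool" where
  "rank_table e b H h \<longleftrightarrow> (\<forall>a c s.
    (H (pair a (pair c s)) \<noteq> 0 \<longrightarrow> (\<forall>n. tree b c h (list_decode (Suc (pair n s))) \<longrightarrow>
      (\<exists>a' N. e (pair N (pair a' a)) h \<and> H (pair a' (pair c (Suc (pair n s)))) \<noteq> 0)))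
    \<and> (H (pair a (pair c s)) = 0 \<longrightarrow> (\<exists>n. tree b c h (list_decode (Suc (pair n s))) \<and>
      (\<forall>a' N. e (pair N (pair a' a)) h \<longrightarrow> H (pair a' (pair c (Suc (pair n s)))) = 0))))"

text \<open>Enumerated in stages \<open>N\<close> rather than decided: a program that decides the
  order from one oracle need not halt with another, while \<open>e\<close> must be decidable for all
  oracles.\<close>

definition enum_lt :: "(nat \<Rightarrow> (nat \<Rightarrow> nat) \<Rightarrow> bool) \<Rightarrow> (nat \<Rightarrow> nat) \<Rightarrow> nat \<Rightarrow> nat \<Rightarrow> bool" where
  "enum_lt e h a' a \<longleftrightarrow> (\<exists>N. e (pair N (pair a' a)) h)"

lemma rank_table_iff:
  assumes "wf {(a', a). enum_lt e h a' a}"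
  shows "rank_table e b H h \<longleftrightarrow>
    (\<forall>a c s. H (pair a (pair c s)) \<noteq> 0 \<longleftrightarrow> ranked (enum_lt e h) (tree b c h) a (list_decode s))"
proof
  assume H: "rank_table e b H h"
  \<comment> \<open>The two implications of \<open>rank_table\<close>, kept apart there so that each
    has a decidable premise, combine to the recursion equation of \<open>ranked\<close>.\<close>
  have H': "H (pair a (pair c s)) \<noteq> 0 \<longleftrightarrow> (\<forall>n. tree b c h (n # list_decode s) \<longrightarrow>
      (\<exists>a'. enum_lt e h a' a \<and> H (pair a' (pair c (Suc (pair n s)))) \<noteq> 0))" for a c s
  proof
    assume "H (pair a (pair c s)) \<noteq> 0"
    with H show "\<forall>n. tree b c h (n # list_decode s) \<longrightarrow>
        (\<exists>a'. enum_lt e h a' a \<and> H (pair a' (pair c (Suc (pair n s)))) \<noteq> 0)"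
      unfolding rank_table_def enum_lt_def by (simp del: neq0_conv)
  next
    assume R: "\<forall>n. tree b c h (n # list_decode s) \<longrightarrow>
        (\<exists>a'. enum_lt e h a' a \<and> H (pair a' (pair c (Suc (pair n s)))) \<noteq> 0)"
    show "H (pair a (pair c s)) \<noteq> 0"
    proof
      assume "H (pair a (pair c s)) = 0"
      then obtain n where n: "tree b c h (list_decode (Suc (pair n s)))"
        "\<And>a' N. e (pair N (pair a' a)) h \<Longrightarrow> H (pair a' (pair c (Suc (pair n s)))) = 0"
        using H unfolding rank_table_def by meson
      from n(1) R obtain a' where a': "enum_lt e h a' a" "H (pair a' (pair c (Suc (pair n s)))) \<noteq> 0"
        by auto
      then obtain N where "e (pair N (pair a' a)) h" unfolding enum_lt_def by blast
      from n(2)[OF this] a'(2) show False by blast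
    qed
  qed
  show "\<forall>a c s. H (pair a (pair c s)) \<noteq> 0 \<longleftrightarrow> ranked (enum_lt e h) (tree b c h) a (list_decode s)"
  proof (intro allI)
    fix a c s
    have "H (pair a (pair c (list_encode t))) \<noteq> 0 \<longleftrightarrow> ranked (enum_lt e h) (tree b c h) a t" for a t
      by (rule ranked_unique[OF assms, where H = "\<lambda>a t. H (pair a (pair c (list_encode t))) \<noteq> 0"])
        (subst H', simp)
    from this[of a "list_decode s"] show "H (pair a (pair c s)) \<noteq> 0
        \<longleftrightarrow> ranked (enum_lt e h) (tree b c h) a (list_decode s)" by simp
  qed
next
  assume H: "\<forall>a c s. H (pair a (pair c s)) \<noteq> 0 \<longleftrightarrow> ranked (enum_lt e h) (tree b c h) a (list_decode s)"
  have H': "H (pair a (pair c s)) = 0 \<longleftrightarrow> \<not> ranked (enum_lt e h) (tree b c h) a (list_decode s)" for a c s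
    using H by blast
  have d: "list_decode (Suc (pair n s)) = n # list_decode s" for n s by simp
  show "rank_table e b H h" unfolding rank_table_def H' d
    by (subst (1 3) ranked_iff) (auto simp: enum_lt_def)
qed

definition sel_graph ::
    "(nat \<Rightarrow> (nat \<Rightarrow> nat) \<Rightarrow> bool) \<Rightarrow> (nat \<Rightarrow> (nat \<Rightarrow> nat) \<Rightarrow> bool) \<Rightarrow> nat \<Rightarrow> (nat \<Rightarrow> nat) \<Rightarrow> bool" where
  "sel_graph e b c h \<longleftrightarrow> (\<exists>H. rank_table e b H h \<and>
    ((\<exists>k. psnd c = Suc k \<and> (\<exists>a. H (pair a (pair (pair (pfst c) k) 0)) \<noteq> 0)
       \<and> (\<forall>i. i < k \<longrightarrow> (\<forall>a. H (pair a (pair (pair (pfst c) i) 0)) = 0)))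
    \<or> psnd c = 0 \<and> (\<forall>k a. H (pair a (pair (pair (pfst c) k) 0)) = 0)))"

lemma sigma_sel_graph:
  assumes e: "decp single e" and b: "decp single b" shows "sigma (sel_graph e b)"
  unfolding sel_graph_def rank_table_def tree_def join_def
  by (intro sintros) (intro sigma_dec cintros decp_single_subst[OF e] decp_single_subst[OF b])+

text \<open>A table exists, and all tables have the same nonzero entries, so the value read off from
  some table is the right one.\<close>

lemma sel_graph_iff:
  assumes wf: "wf {(a', a). enum_lt e h a' a}"
  shows "sel_graph e b (pair n j) h \<longleftrightarrow> sel (enum_lt e h) b h n = j"
proof -
  define H0 :: "nat \<Rightarrow> nat" where "H0 i = of_bool (ranked (enum_lt e h) (tree b (pfst (psnd i)) h) (pfst i)
    (list_decode (psnd (psnd i))))" for i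
  have H0: "rank_table e b H0 h" unfolding rank_table_iff[OF wf] by (simp add: H0_def)
  have R: "H (pair a (pair c 0)) = 0 \<longleftrightarrow> \<not> ranked (enum_lt e h) (tree b c h) a []"
    if "rank_table e b H h" for H a c
    using that[unfolded rank_table_iff[OF wf], rule_format, of a c 0] by auto
  have "sel_graph e b (pair n j) h \<longleftrightarrow> (\<exists>H. rank_table e b H h \<and> sel (enum_lt e h) b h n = j)"
    unfolding sel_graph_def pfst_pair psnd_pair sel_eq_iff
    by (intro ex_cong1 conj_cong refl) (simp only: R not_not)
  then show ?thesis using H0 by blast
qed

section \<open>Graphs in \<open>sigma\<close> and \<open>\<Delta>\<^sup>1\<^sub>1\<close>
  functions\<close>

lemma Pi11_iff: "A \<in> Pi11 k l \<longleftrightarrow> (\<exists>B\<in>Sigma11 k l. A = prod_space k l - B)"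
  unfolding Pi11_def by blast

text \<open>A point lies outside the graph of a total function iff another value is taken, so a
  \<open>\<Sigma>\<^sup>1\<^sub>1\<close> graph has a \<open>\<Sigma>\<^sup>1\<^sub>1\<close>
  complement.\<close>

lemma sigma_graph_complement:
  assumes "sigma \<phi>" shows "sigma (\<lambda>c h. \<exists>j. j \<noteq> psnd c \<and> \<phi> (pair (pfst c) j) h)"
  by (intro sintros) (intro sigma_dec sigma_comp[OF assms] cintros)+

lemma Delta11_functionI:
  assumes "sigma \<phi>" and \<phi>: "\<And>n k h. \<phi> (pair n k) h \<longleftrightarrow> F h n = k"
  shows "Delta11_function F"
proof -
  let ?A = "{([n, k], [h]) | n k h. F h n = k}"
  have "?A \<in> Sigma11 2 1" using Sigma11I[OF assms(1)] unfolding \<phi> .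
  moreover have "?A = prod_space 2 1 - {([n, k], [h]) | n k h. \<exists>j. j \<noteq> k \<and> \<phi> (pair n j) h}"
    unfolding prod_space_2_1 \<phi> by auto
  then have "?A \<in> Pi11 2 1"
    using Sigma11I[OF sigma_graph_complement[OF assms(1)]] unfolding Pi11_iff by auto
  ultimately show ?thesis by (simp add: Delta11_function_def Delta11_def)
qed

text \<open>Only the section at \<open>f\<close> has to be a graph; elsewhere the two sets need not
  be complementary.\<close>

lemma is_Delta11_inI:
  assumes "sigma \<phi>" and \<phi>: "\<And>n k. \<phi> (pair n k) f \<longleftrightarrow> g n = k"
  shows "is_Delta11_in g f"
proof -
  let ?A = "{([n, k], []) | n k. g n = k}"
  let ?C = "{([n, k], [h]) | n k h. \<exists>j. j \<noteq> k \<and> \<phi> (pair n j) h}"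
  have "?A = sect f {([n, k], [h]) | n k h. \<phi> (pair n k) h}"
    by (auto simp: sect_def \<phi>)
  then have 1: "?A \<in> Sigma11_in f 2 0"
    using Sigma11I[OF assms(1)] unfolding Sigma11_in_def by auto
  have "?A = sect f (prod_space 2 1 - ?C)"
    unfolding prod_space_2_1 by (auto simp: sect_def \<phi>)
  moreover have "prod_space 2 1 - ?C \<in> Pi11 2 1"
    using Sigma11I[OF sigma_graph_complement[OF assms(1)]] unfolding Pi11_iff by auto
  ultimately have "?A \<in> Pi11_in f 2 0" unfolding Pi11_in_def by auto
  with 1 show ?thesis by (simp add: is_Delta11_in_def Delta11_in_def)
qed

lemma is_Delta11_in_value:
  assumes "Delta11_function F" shows "is_Delta11_in (F f) f"
proof -
  let ?Q = "{([n, k], [h]) | n k h. F h n = k}"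
  have "?Q \<in> Sigma11 2 1" "?Q \<in> Pi11 2 1"
    using assms by (simp_all add: Delta11_function_def Delta11_def)
  moreover have "{([n, k], []) | n k. F f n = k} = sect f ?Q" by (auto simp: sect_def)
  ultimately show ?thesis
    unfolding is_Delta11_in_def Delta11_in_def Sigma11_in_def Pi11_in_def by auto
qed

section \<open>Computable wellorders and the existence of
  \<open>\<omega>\<^sub>1\<^sup>f\<close>\<close>

lemma computable_rel_iff:
  "computable_rel f R \<longleftrightarrow> decp (\<lambda>_ :: unit. [f]) (\<lambda>c r. (pfst c, psnd c) \<in> R)"
proof
  assume "computable_rel f R"
  then obtain p where p: "\<And>m n. eval [f] p [m, n] (if (m, n) \<in> R then 1 else 0)"
    unfolding computable_rel_def by blast
  have "eval [f] (Comp p [pfst_prog, psnd_prog]) [c] (if (pfst c, psnd c) \<in> R then 1 else 0)" for c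
    by (rule eval_Comp2[OF eval_pfst_prog eval_psnd_prog p])
  then show "decp (\<lambda>_ :: unit. [f]) (\<lambda>c r. (pfst c, psnd c) \<in> R)"
    unfolding decp_def of_bool_def by (intro cfunI)
qed (rule computable_relI)

text \<open>A shorter wellorder is isomorphic to the segment below some \<open>a\<close>, and this
  number can be built into the program.\<close>

lemma computable_segment:
  assumes L: "computable_wellorder f L" and s: "s <o L"
  shows "\<exists>R. computable_wellorder f R \<and> R =o s"
proof -
  have W: "Well_order L" using L by (simp add: computable_wellorder_def)
  obtain a where a: "a \<in> Field L" "s =o Restr L (underS L a)"
    using s W ordLess_iff_ordIso_Restr[of L s] by (auto simp: ordLess_def)
  have "decp (\<lambda>_ :: unit. [f]) (\<lambda>c r. (pfst c, psnd c) \<in> L)"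
    using L by (simp add: computable_wellorder_def computable_rel_iff)
  note L' = decp_comp[OF this, of "\<lambda>c r. pair (F c r) (G c r)" for F G, unfolded pfst_pair psnd_pair]
  have "decp (\<lambda>_ :: unit. [f]) (\<lambda>c r. (pfst c, psnd c) \<in> L \<and> (\<not> pfst c = a \<and> (pfst c, a) \<in> L)
      \<and> (\<not> psnd c = a \<and> (psnd c, a) \<in> L))"
    by (intro L' cintros)
  moreover have "(pfst c, psnd c) \<in> Restr L (underS L a) \<longleftrightarrow>
     (pfst c, psnd c) \<in> L \<and> (\<not> pfst c = a \<and> (pfst c, a) \<in> L) \<and> (\<not> psnd c = a \<and> (psnd c, a) \<in> L)" for c
    by (auto simp: underS_def)
  ultimately have "computable_rel f (Restr L (underS L a))" by (simp add: computable_rel_iff)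
  then show ?thesis using a(2) Well_order_Restr[OF W] ordIso_symmetric
    by (auto simp: computable_wellorder_def)
qed

lemma computable_less_omega1:
  assumes r: "is_omega1 f r" and L: "computable_wellorder f L"
  shows "L <o r"
proof (rule ccontr)
  assume not: "\<not> L <o r"
  have W: "Well_order L" "Well_order r"
    using L r by (simp_all add: computable_wellorder_def is_omega1_def)
  then have "r \<le>o L" using not not_ordLess_iff_ordLeq by blast
  then have "r =o L \<or> r <o L" by (simp add: ordLeq_iff_ordLess_or_ordIso disj_commute)
  then have "\<exists>R. computable_wellorder f R \<and> R =o r"
    using L computable_segment[OF L] ordIso_symmetric by blast
  then show False using r by (simp add: is_omega1_def)
qed

text \<open>A cardinality argument: \<open>cardSuc natLeq\<close> has uncountably many proper
  segments, all countable and no two isomorphic, but there are only countably many programs.\<close>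

lemma ex_noncomputable_wellorder:
  "\<exists>r :: nat rel. Well_order r \<and> \<not> (\<exists>R. computable_wellorder f R \<and> R =o r)"
proof (rule ccontr)
  assume "\<not> ?thesis"
  then have all: "\<exists>R. computable_wellorder f R \<and> R =o r" if "Well_order r" for r :: "nat rel"
    using that by blast
  let ?\<Omega> = "cardSuc natLeq"
  have C: "Card_order ?\<Omega>" by (rule cardSuc_Card_order[OF natLeq_Card_order])
  then have W: "Well_order ?\<Omega>" by (simp add: card_order_on_def)
  define seg where "seg a = Restr ?\<Omega> (underS ?\<Omega> a)" for a
  have seg: "Well_order (seg a)" for a unfolding seg_def by (rule Well_order_Restr[OF W])
  define computes where "computes p a \<longleftrightarrow> (\<exists>R. Well_order R \<and> R =o seg a
    \<and> (\<forall>m n. eval [f] p [m, n] (if (m, n) \<in> R then 1 else 0)))" for p a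
  have ex: "\<exists>p. computes p a" if a: "a \<in> Field ?\<Omega>" for a
  proof -
    have "|underS ?\<Omega> a| <o ?\<Omega>" using card_of_underS[OF C a] .
    then have "|underS ?\<Omega> a| \<le>o natLeq"
      using cardSuc_ordLeq_ordLess[OF natLeq_Card_order card_of_Card_order] by blast
    then have "|underS ?\<Omega> a| \<le>o |UNIV :: nat set|"
      using ordLeq_ordIso_trans ordIso_symmetric[OF card_of_nat] by blast
    \<comment> \<open>The countable segment is copied to a set of numbers, since the assumption
      speaks of orders on \<open>nat\<close>.\<close>
    then obtain g :: "nat set \<Rightarrow> nat" where g: "inj_on g (underS ?\<Omega> a)"
      unfolding card_of_ordLeq[symmetric] by blast
    have "Field (seg a) \<subseteq> underS ?\<Omega> a" unfolding seg_def by (auto simp: Field_def)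
    with g have g': "inj_on g (Field (seg a))" by (rule inj_on_subset)
    have iso: "seg a =o dir_image (seg a) g" using dir_image_ordIso[OF seg g'] .
    have "Well_order (dir_image (seg a) g)" using Well_order_dir_image[OF seg g'] .
    from all[OF this] obtain R where "computable_wellorder f R" "R =o dir_image (seg a) g" by blast
    moreover have "R =o seg a"
      using calculation(2) iso ordIso_symmetric ordIso_transitive by blast
    ultimately show ?thesis unfolding computes_def computable_wellorder_def computable_rel_def by blast
  qed
  define prog where "prog a = (SOME p. computes p a)" for a
  have prog: "computes (prog a) a" if "a \<in> Field ?\<Omega>" for a
    unfolding prog_def using ex[OF that] by (rule someI_ex)
  have eq: "seg a =o seg b" if pa: "computes p a" and pb: "computes p b" for p a b
  proof -
    obtain R where R: "R =o seg a" "\<And>m n. eval [f] p [m, n] (if (m, n) \<in> R then 1 else 0)"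
      using pa unfolding computes_def by blast
    obtain S where S: "S =o seg b" "\<And>m n. eval [f] p [m, n] (if (m, n) \<in> S then 1 else 0)"
      using pb unfolding computes_def by blast
    have "(m, n) \<in> R \<longleftrightarrow> (m, n) \<in> S" for m n
      using eval_deterministic[OF R(2)[of m n] S(2)[of m n]] by (simp split: if_splits)
    then have "R = S" by auto
    then show ?thesis using R(1) S(1) ordIso_symmetric ordIso_transitive by blast
  qed
  have less: "seg a <o seg b" if "(a, b) \<in> ?\<Omega>" "a \<noteq> b" for a b
  proof -
    have "underS ?\<Omega> a \<subset> underS ?\<Omega> b"
    proof
      show "underS ?\<Omega> a \<subseteq> underS ?\<Omega> b"
        using that W unfolding underS_def order_on_defs trans_def antisym_def by blast
      show "underS ?\<Omega> a \<noteq> underS ?\<Omega> b" using that unfolding underS_def by blast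
    qed
    moreover have "wo_rel.ofilter ?\<Omega> (underS ?\<Omega> a)" "wo_rel.ofilter ?\<Omega> (underS ?\<Omega> b)"
      using W by (simp_all add: wo_rel_def wo_rel.underS_ofilter)
    ultimately show ?thesis unfolding seg_def using ofilter_subset_ordLess[OF W] by blast
  qed
  have "inj_on (code \<circ> prog) (Field ?\<Omega>)"
  proof (rule inj_onI, rule ccontr)
    fix a b assume a: "a \<in> Field ?\<Omega>" and b: "b \<in> Field ?\<Omega>" and "(code \<circ> prog) a = (code \<circ> prog) b"
    then have "prog a = prog b" using code_inject by simp
    then have "seg a =o seg b" "seg b =o seg a" using eq prog[OF a] prog[OF b] by metis+
    moreover assume "a \<noteq> b"
    then have "(a, b) \<in> ?\<Omega> \<or> (b, a) \<in> ?\<Omega>"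
      using W a b unfolding order_on_defs total_on_def by blast
    ultimately show False using less[of a b] less[of b a] \<open>a \<noteq> b\<close> not_ordLess_ordIso by blast
  qed
  then have "|Field ?\<Omega>| \<le>o |UNIV :: nat set|" unfolding card_of_ordLeq[symmetric] by blast
  then have "?\<Omega> \<le>o natLeq"
    using card_of_Field_ordIso[OF C] card_of_nat ordIso_symmetric ordIso_ordLeq_trans ordLeq_ordIso_trans
    by blast
  moreover have "natLeq <o ?\<Omega>" by (rule cardSuc_greater[OF natLeq_Card_order])
  ultimately show False using not_ordLess_ordLeq by blast
qed

lemma ex_omega1: "\<exists>r. is_omega1 f r"
proof -
  let ?P = "\<lambda>r :: nat rel. Well_order r \<and> \<not> (\<exists>R. computable_wellorder f R \<and> R =o r)"
  obtain r0 where "r0 \<in> Collect ?P" using ex_noncomputable_wellorder by blast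
  then obtain r where "r \<in> Collect ?P" and min: "\<And>s. (s, r) \<in> ordLess \<Longrightarrow> s \<notin> Collect ?P"
    by (rule wfE_min[OF wf_ordLess]) blast
  then show ?thesis unfolding is_omega1_def by (auto simp: ordLess_def)
qed

lemma wf_strict: "Well_order R \<Longrightarrow> wf {(a, b). strict R a b}"
proof -
  have "{(a, b). strict R a b} = R - Id" by (auto simp: strict_def)
  then show "Well_order R \<Longrightarrow> wf {(a, b). strict R a b}" by (simp add: well_order_on_def)
qed

lemma ordLeq_strict_mono:
  assumes "R \<le>o S" obtains g where "\<And>a b. strict R a b \<Longrightarrow> strict S (g a) (g b)"
proof -
  have W: "Well_order R" using assms by (simp add: ordLeq_def)
  obtain g where g: "embed R S g" using assms by (auto simp: ordLeq_def)
  have "strict S (g a) (g b)" if "strict R a b" for a b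
  proof -
    have "a \<in> Field R" "b \<in> Field R" using that by (auto simp: strict_def Field_def)
    then show ?thesis
      using that embed_compat[OF g] embed_inj_on[OF W g]
      by (auto simp: strict_def compat_def dest: inj_onD)
  qed
  then show ?thesis by (rule that)
qed

section \<open>The theorem\<close>

text \<open>At reals other than \<open>f\<close> the two predicates may be unrelated.\<close>

lemma is_Delta11_inE:
  assumes "is_Delta11_in g f"
  obtains \<phi> \<psi> where "sigma \<phi>" "\<And>n k. \<phi> (pair n k) f \<longleftrightarrow> g n = k"
    "sigma \<psi>" "\<And>n k. \<psi> (pair n k) f \<longleftrightarrow> g n \<noteq> k"
proof -
  let ?A = "{([n, k], []) | n k. g n = k} :: point set"
  have A: "([n, k], []) \<in> ?A \<longleftrightarrow> g n = k" for n k by auto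
  obtain P where P: "P \<in> Sigma11 2 1" "?A = sect f P"
    using assms unfolding is_Delta11_in_def Delta11_in_def Sigma11_in_def by auto
  obtain Q where Q: "Q \<in> Pi11 2 1" "?A = sect f Q"
    using assms unfolding is_Delta11_in_def Delta11_in_def Pi11_in_def by auto
  obtain C where C: "C \<in> Sigma11 2 1" "Q = prod_space 2 1 - C" using Q(1) unfolding Pi11_iff by blast
  obtain \<phi> where \<phi>: "sigma \<phi>" "P = {([n, k], [h]) | n k h. \<phi> (pair n k) h}"
    using P(1) by (rule Sigma11E)
  obtain \<psi> where \<psi>: "sigma \<psi>" "C = {([n, k], [h]) | n k h. \<psi> (pair n k) h}"
    using C(1) by (rule Sigma11E)
  have "\<phi> (pair n k) f \<longleftrightarrow> g n = k" for n k
  proof -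
    have "\<phi> (pair n k) f \<longleftrightarrow> ([n, k], []) \<in> sect f P" unfolding \<phi>(2) sect_def by simp
    then show ?thesis by (simp only: A[of n k, unfolded P(2)])
  qed
  moreover have "\<psi> (pair n k) f \<longleftrightarrow> g n \<noteq> k" for n k
  proof -
    have "\<psi> (pair n k) f \<longleftrightarrow> ([n, k], []) \<notin> sect f Q"
      unfolding C(2) \<psi>(2) prod_space_2_1 sect_def by simp
    then show ?thesis by (simp only: A[of n k, unfolded Q(2)])
  qed
  ultimately show ?thesis by (rule that[OF \<phi>(1) _ \<psi>(1)])
qed

text \<open>For the complement of the graph the program itself is kept, as the diagonal argument
  evaluates at its code.\<close>

lemma Delta11_functionE:
  assumes "Delta11_function F"
  obtains \<phi> p where "sigma \<phi>" "\<And>n k h. \<phi> (pair n k) h \<longleftrightarrow> F h n = k"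
    "\<And>n k h. (\<exists>y. \<not> (\<exists>v. eval [y, h] p [n, k] v)) \<longleftrightarrow> F h n \<noteq> k"
proof -
  let ?A = "{([n, k], [h]) | n k h. F h n = k}"
  have A: "([n, k], [h]) \<in> ?A \<longleftrightarrow> F h n = k" for n k h by auto
  have S: "?A \<in> Sigma11 2 1" "?A \<in> Pi11 2 1"
    using assms by (simp_all add: Delta11_function_def Delta11_def)
  obtain C where C: "C \<in> Sigma11 2 1" "?A = prod_space 2 1 - C" using S(2) unfolding Pi11_iff by blast
  obtain \<phi> where \<phi>: "sigma \<phi>" "?A = {([n, k], [h]) | n k h. \<phi> (pair n k) h}"
    using S(1) by (rule Sigma11E)
  obtain p where p: "C = {([n, k], [h]) | n k h. \<exists>y. \<not> (\<exists>v. eval [y, h] p [n, k] v)}"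
    using C(1) unfolding Sigma11_2_1_iff by blast
  have "\<phi> (pair n k) h \<longleftrightarrow> F h n = k" for n k h
    using A[of n k h] unfolding \<phi>(2) by simp
  moreover have "(\<exists>y. \<not> (\<exists>v. eval [y, h] p [n, k] v)) \<longleftrightarrow> F h n \<noteq> k" for n k h
  proof -
    have "(\<exists>y. \<not> (\<exists>v. eval [y, h] p [n, k] v)) \<longleftrightarrow> ([n, k], [h]) \<notin> ?A"
      unfolding C(2) p prod_space_2_1 by simp
    then show ?thesis using A by simp
  qed
  ultimately show ?thesis by (rule that[OF \<phi>(1)])
qed

text \<open>By soundness of ranks no number other than \<open>k\<close> is ranked.\<close>

lemma sel_eq_Suc:
  assumes "refutes b \<phi>" "ranked lt (tree b (pair n k) h) a []" "\<And>i. i \<noteq> k \<Longrightarrow> \<phi> (pair n i) h"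
  shows "sel lt b h n = Suc k"
proof -
  have "\<not> ranked lt (tree b (pair n i) h) a' []" if "i < k" for i a'
    using ranked_tree[OF assms(1)] assms(3)[of i] that by blast
  then show ?thesis using assms(2) unfolding sel_eq_iff by blast
qed

lemma decp_constant_oracle:
  assumes "decp (\<lambda>_ :: unit. [\<lambda>_. 0]) (\<lambda>c _. P c)" shows "decp D (\<lambda>c r. P c)"
  by (rule decp_subst[OF assms, where L = 1 and H = "\<lambda>c r. c"]) (simp_all add: cfun_id cfun_const)

lemma computable_wellorder_zero:
  assumes "computable_wellorder (\<lambda>_. 0) R" shows "computable_wellorder f R"
  using assms decp_constant_oracle[of "\<lambda>c. (pfst c, psnd c) \<in> R"]
  by (simp add: computable_wellorder_def computable_rel_iff)

lemma hyperlow_iff: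
  assumes r: "is_omega1 f r" and s: "is_omega1 (\<lambda>_. 0) s"
  shows "hyperlow f \<longleftrightarrow> r =o s"
proof
  assume "hyperlow f"
  then obtain r' s' where r': "is_omega1 f r'" and s': "is_omega1 (\<lambda>_. 0) s'" and "r' =o s'"
    unfolding hyperlow_def by blast
  have "r =o s'" using is_omega1_unique[OF r r'] \<open>r' =o s'\<close> by (rule ordIso_transitive)
  then show "r =o s" using is_omega1_unique[OF s' s] by (rule ordIso_transitive)
qed (use r s in \<open>auto simp: hyperlow_def\<close>)

text \<open>An oracle cannot lower \<open>\<omega>\<^sub>1\<close>, so failure of hyperlowness means
  \<open>s <o r\<close>, and then \<open>s\<close> itself has an \<open>f\<close>-computable
  copy.\<close>

lemma not_hyperlow_wellorder:
  assumes "\<not> hyperlow f"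
  obtains R where "computable_wellorder f R"
    "\<And>L. computable_wellorder (\<lambda>_. 0) L \<Longrightarrow> L \<le>o R"
proof -
  obtain r s where r: "is_omega1 f r" and s: "is_omega1 (\<lambda>_. 0) s" using ex_omega1 by metis
  have W: "Well_order r" "Well_order s" using r s by (simp_all add: is_omega1_def)
  have "\<not> r =o s" using assms hyperlow_iff[OF r s] by simp
  moreover have "\<not> r <o s"
  proof
    assume "r <o s"
    then obtain R where "computable_wellorder (\<lambda>_. 0) R" "R =o r" using s unfolding is_omega1_def by blast
    then show False using r computable_wellorder_zero unfolding is_omega1_def by blast
  qed
  ultimately have "s <o r" using W not_ordLess_iff_ordLeq ordLeq_iff_ordLess_or_ordIso ordIso_symmetric
    by blast
  then obtain R where R: "computable_wellorder f R" "R =o s" using r unfolding is_omega1_def by blast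
  have "L \<le>o R" if "computable_wellorder (\<lambda>_. 0) L" for L
    using ordLess_imp_ordLeq[OF computable_less_omega1[OF s that]] ordIso_symmetric[OF R(2)]
    by (rule ordLeq_ordIso_trans)
  with R(1) show ?thesis by (rule that)
qed

lemma ex_Delta11_function:
  assumes "hyperlow f" "is_Delta11_in g f" shows "\<exists>F. Delta11_function F \<and> F f = g"
proof -
  obtain \<phi> \<psi> where \<phi>: "sigma \<phi>" "\<And>n k. \<phi> (pair n k) f \<longleftrightarrow> g n = k"
    and \<psi>: "sigma \<psi>" "\<And>n k. \<psi> (pair n k) f \<longleftrightarrow> g n \<noteq> k"
    using assms(2) by (rule is_Delta11_inE) blast
  obtain b where b: "refutes b \<psi>" using \<psi>(1) by (rule refutesE)
  \<comment> \<open>Joined with the parameter \<open>f\<close>, this forces \<open>z = f\<close>: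
    the two predicates are known to be disjoint at \<open>f\<close> only.\<close>
  define B where "B c u \<longleftrightarrow> (\<forall>i. u (2 * i) = u (Suc (2 * i))) \<and> \<phi> c (\<lambda>i. u (2 * i))" for c u
  have "sigma B" unfolding B_def
    by (intro sintros sigma_subst[OF \<phi>(1)]) (intro sigma_dec cintros)+
  moreover have B: "B c (join z f) \<longleftrightarrow> z = f \<and> \<phi> c f" for c z
    unfolding B_def join_even join_odd fun_eq_iff[symmetric] by auto
  have "\<not> \<psi> c z" if "B c (join z f)" for c z
    using that \<phi>(2)[of "pfst c" "psnd c"] \<psi>(2)[of "pfst c" "psnd c"] unfolding B by simp
  ultimately obtain L where L: "computable_wellorder f L"
    "\<And>c z. B c (join z f) \<Longrightarrow> \<exists>a. ranked (strict L) (tree b c z) a []"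
    using boundedness[OF b] by blast
  obtain r s where r: "is_omega1 f r" and s: "is_omega1 (\<lambda>_. 0) s" and rs: "r =o s"
    using assms(1) unfolding hyperlow_def by blast
  have "L <o s" using computable_less_omega1[OF r L(1)] rs by (rule ordLess_ordIso_trans)
  then obtain R where R: "computable_wellorder (\<lambda>_. 0) R" "R =o L"
    using s unfolding is_omega1_def by blast
  have wf: "wf {(a', a). strict R a' a}" using R(1) wf_strict by (simp add: computable_wellorder_def)
  have "L \<le>o R" using R(2) ordIso_symmetric ordIso_iff_ordLeq by blast
  then obtain t where t: "\<And>a b. strict L a b \<Longrightarrow> strict R (t a) (t b)" by (rule ordLeq_strict_mono) blast
  \<comment> \<open>The oracle is ignored, so the enumerated order is \<open>R\<close>, and hence
    wellfounded, for every \<open>h\<close>.\<close>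
  define e where "e c z \<longleftrightarrow> strict R (pfst (psnd c)) (psnd (psnd c))" for c and z :: "nat \<Rightarrow> nat"
  have "decp single (\<lambda>c z. (pfst c, psnd c) \<in> R)"
    by (rule decp_constant_oracle)
      (use R(1) in \<open>simp add: computable_wellorder_def computable_rel_iff\<close>)
  from decp_comp[OF this cfun_psnd[OF cfun_id]] have e: "decp single e"
    unfolding e_def strict_def by (intro cintros)
  have e_lt: "enum_lt e h = strict R" for h by (simp add: fun_eq_iff enum_lt_def e_def)
  \<comment> \<open>The subtraction undoes the shift in \<open>sel\<close> and gives the default 0
    where nothing is ranked, which accounts for the second disjunct of \<open>?G\<close>.\<close>
  define F where "F h n = sel (strict R) b h n - 1" for h n
  let ?G = "\<lambda>c h. sel_graph e b (pair (pfst c) (Suc (psnd c))) h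
    \<or> psnd c = 0 \<and> sel_graph e b (pair (pfst c) 0) h"
  have "sigma ?G"
    by (intro sintros sigma_comp[OF sigma_sel_graph[OF e refutes_dec[OF b]]]) (intro sigma_dec cintros)+
  moreover have "?G (pair n k) h \<longleftrightarrow> F h n = k" for n k h
    using sel_graph_iff[of e h b] wf by (auto simp: e_lt F_def)
  ultimately have "Delta11_function F" by (rule Delta11_functionI)
  moreover have "F f = g"
  proof
    fix n
    obtain a where "ranked (strict L) (tree b (pair n (g n)) f) a []"
      using L(2)[of "pair n (g n)" f] \<phi>(2) by (auto simp: B)
    then have "ranked (strict R) (tree b (pair n (g n)) f) (t a) []" by (rule ranked_transfer[rotated]) (rule t)
    from sel_eq_Suc[OF b this] \<psi>(2) show "F f n = g n" by (auto simp: F_def)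
  qed
  ultimately show ?thesis by blast
qed

lemma ex_Delta11_diagonal:
  assumes "\<not> hyperlow f"
  shows "\<exists>g. is_Delta11_in g f \<and> \<not> (\<exists>F. Delta11_function F \<and> F f = g)"
proof -
  obtain R where R: "computable_wellorder f R"
    and above: "\<And>L. computable_wellorder (\<lambda>_. 0) L \<Longrightarrow> L \<le>o R"
    using assms by (rule not_hyperlow_wellorder) blast
  have wf: "wf {(a', a). strict R a' a}" using R wf_strict by (simp add: computable_wellorder_def)
  obtain p where p: "\<And>m n. eval [f] p [m, n] (if (m, n) \<in> R then 1 else 0)"
    using R unfolding computable_wellorder_def computable_rel_def by blast
  \<comment> \<open>The program of \<open>R\<close> is run on an arbitrary oracle, and
    \<open>Suc 1\<close> is the output 1 as returned by \<open>ev\<close>. Wellfoundedness of the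
    enumerated order is known only at the oracle \<open>f\<close>.\<close>
  define e where "e c z \<longleftrightarrow> ev (pfst c) [z] p [pfst (psnd c), psnd (psnd c)] = Suc 1
    \<and> pfst (psnd c) \<noteq> psnd (psnd c)" for c z
  have l: "list_decode (Suc (pair m (Suc (pair n 0)))) = [m, n]" for m n by simp
  have X: "coracles single 1 (\<lambda>c z. [z])"
    unfolding coracles_def by (auto intro!: cfun_single cfun_pfst cfun_id)
  have "decp single (\<lambda>c z. ev (pfst c) [z] p
      (list_decode (Suc (pair (pfst (psnd c)) (Suc (pair (psnd (psnd c)) 0))))) = Suc 1
      \<and> pfst (psnd c) \<noteq> psnd (psnd c))"
    by (intro cintros cfun_ev[where L = 1] X)
  then have e: "decp single e" unfolding e_def l .
  have "(\<exists>N. ev N [f] p [m, n] = Suc 1) \<longleftrightarrow> (m, n) \<in> R" for m n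
    unfolding eval_iff_ev[symmetric] using p[of m n] eval_deterministic[OF p[of m n], of 1]
    by (auto split: if_splits)
  then have e_lt: "enum_lt e f = strict R"
    by (simp add: fun_eq_iff enum_lt_def e_def strict_def)
  obtain b where b: "refutes b diverges" using sigma_diverges by (rule refutesE)
  define g where "g n = sel (strict R) b f n" for n
  have "is_Delta11_in g f"
    by (rule is_Delta11_inI[OF sigma_sel_graph[OF e refutes_dec[OF b]]])
      (use sel_graph_iff[of e f b] wf in \<open>simp add: e_lt g_def\<close>)
  moreover have False if F: "Delta11_function F" and eq: "F f = g" for F
  proof -
    obtain \<phi> q where \<phi>: "sigma \<phi>" "\<And>n k h. \<phi> (pair n k) h \<longleftrightarrow> F h n = k"
      and q: "\<And>n k h. (\<exists>y. \<not> (\<exists>v. eval [y, h] q [n, k] v)) \<longleftrightarrow> F h n \<noteq> k"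
      using F by (rule Delta11_functionE) blast
    have div: "diverges (pair (code q) k) h \<longleftrightarrow> F h (code q) \<noteq> k" for k h
      unfolding diverges_code q ..
    define B where "B c u \<longleftrightarrow> pfst c = code q \<and> \<phi> c (\<lambda>i. u (2 * i))" for c u
    have "sigma B" unfolding B_def
      by (intro sintros sigma_subst[OF \<phi>(1)]) (intro sigma_dec cintros)+
    moreover have B: "B c (join z x) \<longleftrightarrow> pfst c = code q \<and> \<phi> c z" for c z x
      unfolding B_def by simp
    have "\<not> diverges c z" if "B c (join z (\<lambda>_. 0))" for c z
    proof -
      have "c = pair (code q) (psnd c)" "\<phi> c z" using that pair_pfst_psnd[of c] unfolding B by auto
      then show ?thesis using div[of "psnd c" z] \<phi>(2)[of "code q" "psnd c" z] by metis
    qed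
    ultimately obtain L where L: "computable_wellorder (\<lambda>_. 0) L"
      "\<And>c z. B c (join z (\<lambda>_. 0)) \<Longrightarrow> \<exists>a. ranked (strict L) (tree b c z) a []"
      using boundedness[OF b] by blast
    obtain t where t: "\<And>a b. strict L a b \<Longrightarrow> strict R (t a) (t b)"
      using above[OF L(1)] by (rule ordLeq_strict_mono) blast
    let ?k = "F f (code q)"
    obtain a where "ranked (strict L) (tree b (pair (code q) ?k) f) a []"
      using L(2)[of "pair (code q) ?k" f] \<phi>(2) by (auto simp: B)
    then have "ranked (strict R) (tree b (pair (code q) ?k) f) (t a) []" by (rule ranked_transfer[rotated]) (rule t)
    \<comment> \<open>By \<open>div\<close>, every value except \<open>?k\<close> diverges in the
      row of \<open>code q\<close>, so the selection is forced to be \<open>Suc ?k\<close>, whereas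
      \<open>F f = g\<close> demands \<open>?k\<close>.\<close>
    from sel_eq_Suc[OF b this] have "g (code q) = Suc ?k" by (simp add: g_def div)
    then show False using eq by simp
  qed
  ultimately show ?thesis by blast
qed

theorem theorem7:
  fixes f :: "nat \<Rightarrow> nat"
  shows "hyperlow f \<longleftrightarrow>
    (\<forall>g :: nat \<Rightarrow> nat. is_Delta11_in g f \<longleftrightarrow> (\<exists>F. Delta11_function F \<and> F f = g))"
proof
  assume "hyperlow f"
  then show "\<forall>g. is_Delta11_in g f \<longleftrightarrow> (\<exists>F. Delta11_function F \<and> F f = g)"
    using ex_Delta11_function is_Delta11_in_value by blast
next
  assume "\<forall>g. is_Delta11_in g f \<longleftrightarrow> (\<exists>F. Delta11_function F \<and> F f = g)"
  then show "hyperlow f" using ex_Delta11_diagonal by blast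
qed

end
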